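(* Let the parameters be regular and let $\boldsymbol n\in\mathbb N_0^p$, $\boldsymbol m\in\mathbb N_0^q$ with $\boldsymbol m$ near the diagonal and the parameters admissible for $\boldsymbol m$ (see context). Then the mixed problems below have one-dimensional solution spaces (weak normality). More precisely: (A) If $|\boldsymbol n|=|\boldsymbol m|+1$, every column vector $\mathbf P=(P^{(1)},\dots,P^{(p)})^{\mathsf T}$ of polynomials with $P^{(i)}\in\mathbb P_{n_i-1}$ (so $P^{(i)}\equiv0$ if $n_i=0$) satisfying $$\sum_{i=1}^p\oint_{\mathbb T}z^\ell C_{j,i}(z)P^{(i)}(z)\frac{\mathrm dz}{2\pi\mathrm i}=0,\qquad 1\le j\le q,\ 0\le\ell\le m_j-1,$$ is a scalar multiple of $\mathbf A_{\boldsymbol n,\boldsymbol m}$, which is itself a nonzero solution. (B) If $|\boldsymbol m|=|\boldsymbol n|+1$, every row vector $\mathbf Q=(Q^{(1)},\dots,Q^{(q)})$ of polynomials with $Q^{(j)}\in\mathbb P_{m_j-1}$ (so $Q^{(j)}\equiv0$ if $m_j=0$) satisfying $$\sum_{j=1}^q\oint_{\mathbb T}z^\ell Q^{(j)}(z)C_{j,i}(z)\frac{\mathrm dz}{2\pi\mathrm i}=0,\qquad 1\le i\le p,\ 0\le\ell\le n_i-1,$$ is a scalar multiple of $\mathbf B_{\boldsymbol n,\boldsymbol m}$, which is itself a nonzero solution.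
   Context: Notation. $\mathbf 1_d$: all-ones vector; $\boldsymbol e_j$: standard basis vector; $|\boldsymbol n|=\sum n_i$; $\boldsymbol c^{*i}$: $\boldsymbol c$ with its $i$-th component removed. $(x)_n=\Gamma(x+n)/\Gamma(x)$; for vectors $\Gamma(\boldsymbol v)=\prod_h\Gamma(v_h)$, $(\boldsymbol c)_{\boldsymbol m}=\prod_h(c_h)_{m_h}$, a scalar subscript is applied to each component; empty products are $1$. $\mathbb P_N$: complex polynomials of degree $\le N$, $\mathbb P_{-1}=\{0\}$. $\mathbb T$: positively oriented unit circle. $\mathbb Z_{\le0}=\{0,-1,\dots\}$. Parameters: $p,q\ge1$, $0\le r<q$, $\boldsymbol a\in\mathbb C^r$, $\boldsymbol b\in\mathbb C^q$, $\boldsymbol\kappa\in\mathbb C^p$; regular: $b_j-b_h\notin\mathbb Z$ $(j\ne h)$, $\kappa_i-\kappa_h\notin\mathbb Z$ $(i\ne h)$. Weights: $C_{j,i}(z)=\sum_{k\ge0}\frac{\Gamma((k+\kappa_i)\mathbf 1_r+\boldsymbol a+\mathbf 1_r)}{\Gamma((k+\kappa_i)\mathbf 1_q+\boldsymbol b+\boldsymbol e_j+\mathbf 1_q)}z^{-k-1}$. $\boldsymbol m$ near the diagonal: $|m_j-m_h|\le1$ for all $j,h$; $m_{\min}=\min_hm_h$, $j_{\min}=\min\{j:m_j=m_{\min}\}$. Admissible for $\boldsymbol m$: for all $i,j,\rho$, $\kappa_i+a_\rho+1\notin\mathbb Z_{\le0}$, $\kappa_i+b_j+1\notin\mathbb Z_{\le0}$;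 $a_\rho-b_j-m_j+1\notin\mathbb Z_{\le0}$ whenever $m_j\ge1$; $a_\rho-b_{j_{\min}}-m_{\min}\notin\mathbb Z_{\le0}$. Explicit vectors (up to a nonzero scalar factor). If $|\boldsymbol n|=|\boldsymbol m|+1$: $A^{(i)}_{\boldsymbol n,\boldsymbol m}=0$ if $n_i=0$, otherwise $$A^{(i)}_{\boldsymbol n,\boldsymbol m}(z)=C_{\boldsymbol n,\boldsymbol m;i}\sum_{k=0}^{n_i-1}\frac{(1-n_i)_k(\kappa_i\mathbf 1_q+\boldsymbol b+\boldsymbol m+\mathbf 1_q)_k(\kappa_i\mathbf 1_{p-1}-\boldsymbol\kappa^{*i}-\boldsymbol n^{*i}+\mathbf 1_{p-1})_k}{(\kappa_i\mathbf 1_r+\boldsymbol a+\mathbf 1_r)_k(\kappa_i\mathbf 1_{p-1}-\boldsymbol\kappa^{*i}+\mathbf 1_{p-1})_k}\frac{z^k}{k!},$$ $$C_{\boldsymbol n,\boldsymbol m;i}=(-1)^{|\boldsymbol n|}\frac{\Gamma(\kappa_i\mathbf 1_q+\boldsymbol b+\mathbf 1_q)}{\Gamma(\kappa_i\mathbf 1_r+\boldsymbol a+\mathbf 1_r)}\frac{\prod_{j}(\kappa_i+b_j+1)_{m_j}}{(-1)^{n_i-1}(n_i-1)!\prod_{\ell\ne i}(\kappa_i-\kappa_\ell-n_\ell+1)_{n_\ell}}.$$ If $|\boldsymbol m|=|\boldsymbol n|+1$: $B^{(j)}_{\boldsymbol n,\boldsymbol m}=0$ if $m_j=0$, otherwise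 $$B^{(j)}_{\boldsymbol n,\boldsymbol m}(z)=\pi_{j,0}+\frac{(\boldsymbol a-b_j\mathbf 1_r)_1}{(\boldsymbol b^{*j}-b_j\mathbf 1_{q-1})_1}\sum_{H=1}^q\sum_{K=1}^{m_H-1}\pi_{H,K}\frac{(\boldsymbol b^{*j}-(b_H+K)\mathbf 1_{q-1})_1}{(\boldsymbol a-(b_H+K)\mathbf 1_r)_1}\sum_{d=0}^{K-1+\delta_{j,H}}\frac{(\boldsymbol b-(b_H+K)\mathbf 1_q+\mathbf 1_q-\boldsymbol e_j)_d}{(\boldsymbol a-(b_H+K)\mathbf 1_r+\mathbf 1_r)_d}z^d,$$ $$\pi_{H,K}=-\frac{\prod_{i}(\kappa_i+b_H+K+1)_{n_i}}{(-1)^KK!(m_H-K-1)!\prod_{I\ne H}(b_I-b_H-K)_{m_I}}.$$ *)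

theory Defs
  imports "HOL-Complex_Analysis.Complex_Analysis" "HOL-Library.Function_Algebras"
    "HOL-Library.Nonpos_Ints"
begin

text \<open>
  Vectors of length \<open>p\<close> are functions on \<open>nat\<close> read only at the
  indices \<open>1, \<dots>, p\<close>; this keeps \<open>r = 0\<close> available, which a finite
  index type would not.
\<close>

definition regular :: "nat \<Rightarrow> nat \<Rightarrow> (nat \<Rightarrow> complex) \<Rightarrow> (nat \<Rightarrow> complex) \<Rightarrow> bool" where
  "regular p q b \<kappa> \<longleftrightarrow>
     (\<forall>j\<in>{1..q}. \<forall>h\<in>{1..q}. j \<noteq> h \<longrightarrow> b j - b h \<notin> \<int>) \<and>
     (\<forall>i\<in>{1..p}. \<forall>h\<in>{1..p}. i \<noteq> h \<longrightarrow> \<kappa> i - \<kappa> h \<notin> \<int>)"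

definition near_diagonal :: "nat \<Rightarrow> (nat \<Rightarrow> nat) \<Rightarrow> bool" where
  "near_diagonal q m \<longleftrightarrow>
     (\<forall>j\<in>{1..q}. \<forall>h\<in>{1..q}. \<bar>int (m j) - int (m h)\<bar> \<le> 1)"

definition m_min :: "nat \<Rightarrow> (nat \<Rightarrow> nat) \<Rightarrow> nat" where
  "m_min q m = Min (m ` {1..q})"

definition j_min :: "nat \<Rightarrow> (nat \<Rightarrow> nat) \<Rightarrow> nat" where
  "j_min q m = Min {j\<in>{1..q}. m j = m_min q m}"

definition admissible ::
  "nat \<Rightarrow> nat \<Rightarrow> nat \<Rightarrow> (nat \<Rightarrow> complex) \<Rightarrow> (nat \<Rightarrow> complex) \<Rightarrow> (nat \<Rightarrow> complex) \<Rightarrow> (nat \<Rightarrow> nat) \<Rightarrow> bool"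
where
  "admissible p q r a b \<kappa> m \<longleftrightarrow>
     (\<forall>i\<in>{1..p}. \<forall>\<rho>\<in>{1..r}. \<kappa> i + a \<rho> + 1 \<notin> \<int>\<^sub>\<le>\<^sub>0) \<and>
     (\<forall>i\<in>{1..p}. \<forall>j\<in>{1..q}. \<kappa> i + b j + 1 \<notin> \<int>\<^sub>\<le>\<^sub>0) \<and>
     (\<forall>j\<in>{1..q}. \<forall>\<rho>\<in>{1..r}. 1 \<le> m j \<longrightarrow> a \<rho> - b j - of_nat (m j) + 1 \<notin> \<int>\<^sub>\<le>\<^sub>0) \<and>
     (\<forall>\<rho>\<in>{1..r}. a \<rho> - b (j_min q m) - of_nat (m_min q m) \<notin> \<int>\<^sub>\<le>\<^sub>0)"

text \<open>
  The weight \<open>C\<^bsub>j,i\<^esub>\<close>. As \<open>r < q\<close>, the series converges for every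
  \<open>z \<noteq> 0\<close>. The summand \<open>of_bool (h = j)\<close> is the component
  \<open>h\<close> of the basis vector \<open>e\<^sub>j\<close>.
\<close>

definition weight ::
  "nat \<Rightarrow> nat \<Rightarrow> (nat \<Rightarrow> complex) \<Rightarrow> (nat \<Rightarrow> complex) \<Rightarrow> (nat \<Rightarrow> complex) \<Rightarrow> nat \<Rightarrow> nat \<Rightarrow> complex \<Rightarrow> complex"
where
  "weight q r a b \<kappa> j i z =
     (\<Sum>k. (\<Prod>\<rho>\<in>{1..r}. Gamma (of_nat k + \<kappa> i + a \<rho> + 1)) /
           (\<Prod>h\<in>{1..q}. Gamma (of_nat k + \<kappa> i + b h + of_bool (h = j) + 1)) *
           (1 / z ^ (k + 1)))"

text \<open>The degree bound is an integer so that \<open>polys_le (- 1) = {0}\<close>.\<close>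

definition polys_le :: "int \<Rightarrow> complex poly set" where
  "polys_le N = {P. P = 0 \<or> int (degree P) \<le> N}"

definition circle_mean :: "(complex \<Rightarrow> complex) \<Rightarrow> complex" where
  "circle_mean f = contour_integral (circlepath 0 1) (\<lambda>z. f z / (2 * of_real pi * \<i>))"

text \<open>
  Vectors of polynomials are extended by zero outside their index range, so that
  the solution sets below are sets of functions, with pointwise operations.
\<close>

definition solutions_A ::
  "nat \<Rightarrow> nat \<Rightarrow> nat \<Rightarrow> (nat \<Rightarrow> complex) \<Rightarrow> (nat \<Rightarrow> complex) \<Rightarrow> (nat \<Rightarrow> complex) \<Rightarrow>
   (nat \<Rightarrow> nat) \<Rightarrow> (nat \<Rightarrow> nat) \<Rightarrow> (nat \<Rightarrow> complex poly) set"
where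
  "solutions_A p q r a b \<kappa> n m =
     {P. (\<forall>i\<in>{1..p}. P i \<in> polys_le (int (n i) - 1)) \<and>
         (\<forall>i. i \<notin> {1..p} \<longrightarrow> P i = 0) \<and>
         (\<forall>j\<in>{1..q}. \<forall>l<m j.
            (\<Sum>i\<in>{1..p}. circle_mean (\<lambda>z. z ^ l * weight q r a b \<kappa> j i z * poly (P i) z)) = 0)}"

definition solutions_B ::
  "nat \<Rightarrow> nat \<Rightarrow> nat \<Rightarrow> (nat \<Rightarrow> complex) \<Rightarrow> (nat \<Rightarrow> complex) \<Rightarrow> (nat \<Rightarrow> complex) \<Rightarrow>
   (nat \<Rightarrow> nat) \<Rightarrow> (nat \<Rightarrow> nat) \<Rightarrow> (nat \<Rightarrow> complex poly) set"
where
  "solutions_B p q r a b \<kappa> n m =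
     {Q. (\<forall>j\<in>{1..q}. Q j \<in> polys_le (int (m j) - 1)) \<and>
         (\<forall>j. j \<notin> {1..q} \<longrightarrow> Q j = 0) \<and>
         (\<forall>i\<in>{1..p}. \<forall>l<n i.
            (\<Sum>j\<in>{1..q}. circle_mean (\<lambda>z. z ^ l * poly (Q j) z * weight q r a b \<kappa> j i z)) = 0)}"

definition vec_scale :: "complex \<Rightarrow> (nat \<Rightarrow> complex poly) \<Rightarrow> nat \<Rightarrow> complex poly" where
  "vec_scale c P = (\<lambda>i. smult c (P i))"

lemma vector_space_vec_scale: "vector_space vec_scale"
  by unfold_locales (auto simp: vec_scale_def fun_eq_iff smult_add_right smult_add_left)

definition one_dimensional :: "(nat \<Rightarrow> complex poly) set \<Rightarrow> bool" where
  "one_dimensional S \<longleftrightarrow> module.subspace vec_scale S \<and> vector_space.dim vec_scale S = 1"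

definition C_A ::
  "nat \<Rightarrow> nat \<Rightarrow> nat \<Rightarrow> (nat \<Rightarrow> complex) \<Rightarrow> (nat \<Rightarrow> complex) \<Rightarrow> (nat \<Rightarrow> complex) \<Rightarrow>
   (nat \<Rightarrow> nat) \<Rightarrow> (nat \<Rightarrow> nat) \<Rightarrow> nat \<Rightarrow> complex"
where
  "C_A p q r a b \<kappa> n m i =
     (- 1) ^ (\<Sum>l\<in>{1..p}. n l) *
     ((\<Prod>j\<in>{1..q}. Gamma (\<kappa> i + b j + 1)) / (\<Prod>\<rho>\<in>{1..r}. Gamma (\<kappa> i + a \<rho> + 1))) *
     ((\<Prod>j\<in>{1..q}. pochhammer (\<kappa> i + b j + 1) (m j)) /
      ((- 1) ^ (n i - 1) * fact (n i - 1) *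
       (\<Prod>l\<in>{1..p} - {i}. pochhammer (\<kappa> i - \<kappa> l - of_nat (n l) + 1) (n l))))"

definition vec_A ::
  "nat \<Rightarrow> nat \<Rightarrow> nat \<Rightarrow> (nat \<Rightarrow> complex) \<Rightarrow> (nat \<Rightarrow> complex) \<Rightarrow> (nat \<Rightarrow> complex) \<Rightarrow>
   (nat \<Rightarrow> nat) \<Rightarrow> (nat \<Rightarrow> nat) \<Rightarrow> nat \<Rightarrow> complex poly"
where
  "vec_A p q r a b \<kappa> n m i =
     (if i \<notin> {1..p} \<or> n i = 0 then 0
      else smult (C_A p q r a b \<kappa> n m i)
        (\<Sum>k\<in>{0..n i - 1}. monom
           (pochhammer (1 - of_nat (n i)) k *
            (\<Prod>j\<in>{1..q}. pochhammer (\<kappa> i + b j + of_nat (m j) + 1) k) *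
            (\<Prod>l\<in>{1..p} - {i}. pochhammer (\<kappa> i - \<kappa> l - of_nat (n l) + 1) k) /
            ((\<Prod>\<rho>\<in>{1..r}. pochhammer (\<kappa> i + a \<rho> + 1) k) *
             (\<Prod>l\<in>{1..p} - {i}. pochhammer (\<kappa> i - \<kappa> l + 1) k)) /
            fact k) k))"

definition pi_B ::
  "nat \<Rightarrow> nat \<Rightarrow> (nat \<Rightarrow> complex) \<Rightarrow> (nat \<Rightarrow> complex) \<Rightarrow>
   (nat \<Rightarrow> nat) \<Rightarrow> (nat \<Rightarrow> nat) \<Rightarrow> nat \<Rightarrow> nat \<Rightarrow> complex"
where
  "pi_B p q b \<kappa> n m H K =
     - ((\<Prod>i\<in>{1..p}. pochhammer (\<kappa> i + b H + of_nat K + 1) (n i)) /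
        ((- 1) ^ K * fact K * fact (m H - K - 1) *
         (\<Prod>I\<in>{1..q} - {H}. pochhammer (b I - b H - of_nat K) (m I))))"

text \<open>
  The range \<open>{1..m H - 1}\<close> is empty for \<open>m H = 0\<close> and for
  \<open>m H = 1\<close>. The upper limit \<open>K - 1 + of_bool (j = H)\<close> is only used for
  \<open>K \<ge> 1\<close>. Hence truncated subtraction is harmless in both places.
\<close>

definition vec_B ::
  "nat \<Rightarrow> nat \<Rightarrow> nat \<Rightarrow> (nat \<Rightarrow> complex) \<Rightarrow> (nat \<Rightarrow> complex) \<Rightarrow> (nat \<Rightarrow> complex) \<Rightarrow>
   (nat \<Rightarrow> nat) \<Rightarrow> (nat \<Rightarrow> nat) \<Rightarrow> nat \<Rightarrow> complex poly"
where
  "vec_B p q r a b \<kappa> n m j =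
     (if j \<notin> {1..q} \<or> m j = 0 then 0
      else [:pi_B p q b \<kappa> n m j 0:] +
        smult ((\<Prod>\<rho>\<in>{1..r}. pochhammer (a \<rho> - b j) 1) /
               (\<Prod>h\<in>{1..q} - {j}. pochhammer (b h - b j) 1))
          (\<Sum>H\<in>{1..q}. \<Sum>K\<in>{1..m H - 1}.
             smult (pi_B p q b \<kappa> n m H K *
                    ((\<Prod>h\<in>{1..q} - {j}. pochhammer (b h - (b H + of_nat K)) 1) /
                     (\<Prod>\<rho>\<in>{1..r}. pochhammer (a \<rho> - (b H + of_nat K)) 1)))
               (\<Sum>d\<in>{0..K - 1 + of_bool (j = H)}. monom
                  ((\<Prod>h\<in>{1..q}. pochhammer (b h - (b H + of_nat K) + 1 - of_bool (h = j)) d) /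
                   (\<Prod>\<rho>\<in>{1..r}. pochhammer (a \<rho> - (b H + of_nat K) + 1) d)) d)))"

end

theory Submission
  imports Defs
begin

text \<open>
  Put \<open>W x = gamma_quot x\<close>. The moments of the weights are the values
  \<open>W (\<kappa> i + k) * ratfun j l (\<kappa> i + k)\<close> at the nodes \<open>\<kappa> i + k\<close>, so (A) and (B) are the
  two dual linear problems for the matrix of values of the \<open>|m|\<close> rational functions
  \<open>ratfun j l\<close> at the \<open>|n|\<close> nodes. Near the diagonal these functions have the common
  denominator \<open>denom\<close> of degree \<open>|m|\<close>, and a telescoping sum expands every partial fraction
  \<open>1 / (x + b H + K + 1)\<close> in them. Hence they span the quotients \<open>f / denom\<close> with
  \<open>deg f < |m|\<close>. In (A) the solutions are then the functionals on nodes that kill all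
  polynomials of degree at most \<open>|n| - 2\<close>, which are the multiples of a divided difference.
  In (B) the numerator is a polynomial of degree at most \<open>|n|\<close> vanishing at the \<open>|n|\<close>
  nodes, and \<open>vec_B\<close> is its partial fraction decomposition.
\<close>

section \<open>Moments of the weights\<close>

text \<open>Read as Cauchy's formula for the \<open>t\<close>-th derivative of \<open>u ^ n\<close>
  at 0, which treats holomorphic integrands and those with a pole alike.\<close>

lemma circlepath_integral_monomial:
  "((\<lambda>z. z ^ n / z ^ Suc t / (2 * of_real pi * \<i>)) has_contour_integral of_bool (t = n)) (circlepath 0 1)"
proof -
  have "((\<lambda>u. u ^ n / (u - 0) ^ Suc t) has_contour_integral
          2 * pi * \<i> / fact t * (deriv ^^ t) (\<lambda>u. u ^ n) 0) (circlepath 0 1)"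
    by (rule Cauchy_has_contour_integral_higher_derivative_circlepath)
       (auto intro!: continuous_intros holomorphic_intros)
  moreover have "(deriv ^^ t) (\<lambda>u::complex. u ^ n) 0 = fact t * of_bool (t = n)"
  proof -
    have "(deriv ^^ t) (\<lambda>u::complex. u ^ n) 0 = pochhammer (of_nat (Suc n - t)) t * 0 ^ (n - t)"
      using higher_deriv_power[of t 0 n 0] by simp
    also have "\<dots> = fact t * of_bool (t = n)"
    proof (cases t n rule: linorder_cases)
      \<comment> \<open>Here \<open>n - t\<close> truncates to 0, so \<open>0 ^ (n - t)\<close> is
        1; the derivative vanishes through the Pochhammer factor with base 0.\<close>
      case greater
      then have "Suc n - t = 0" and "t > 0" by simp_all
      with greater show ?thesis by (simp add: pochhammer_0_left)
    qed (simp_all add: pochhammer_fact)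
    finally show ?thesis .
  qed
  ultimately have "((\<lambda>u. u ^ n / u ^ Suc t) has_contour_integral
          2 * of_real pi * \<i> * of_bool (t = n)) (circlepath 0 1)"
    by (cases "t = n") (simp_all add: mult.assoc del: power_Suc)
  from has_contour_integral_div[OF this, of "2 * of_real pi * \<i>"] show ?thesis
    by (subst (asm) nonzero_mult_div_cancel_left) simp_all
qed

text \<open>The series is integrated term by term: on the unit circle, absolute summability of
  \<open>c\<close> gives uniform convergence by the Weierstrass test.\<close>

lemma circlepath_integral_power_series:
  assumes "summable (\<lambda>t. norm (c t :: complex))"
  shows "((\<lambda>z. z ^ n * (\<Sum>t. c t * (1 / z ^ (t + 1))) / (2 * of_real pi * \<i>))
            has_contour_integral c n) (circlepath 0 1)"
proof -
  define f where "f = (\<lambda>t z. c t * (z ^ n / z ^ Suc t / (2 * of_real pi * \<i>)))"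
  have int: "((\<lambda>z. \<Sum>t<M. f t z) has_contour_integral (\<Sum>t<M. c t * of_bool (t = n))) (circlepath 0 1)" for M
    unfolding f_def by (intro has_contour_integral_sum has_contour_integral_lmul circlepath_integral_monomial) auto
  have ul: "uniform_limit (sphere 0 1) (\<lambda>M z. \<Sum>t<M. f t z) (\<lambda>z. \<Sum>t. f t z) sequentially"
  proof (rule Weierstrass_m_test)
    show "summable (\<lambda>t. norm (c t) * (1 / (2 * pi)))"
      using assms by (rule summable_mult2)
  qed (auto simp: f_def norm_mult norm_divide norm_power)
  have int': "(\<lambda>z. \<Sum>t<M. f t z) contour_integrable_on circlepath 0 1" for M
    using int contour_integrable_on_def by blast
  note lim = contour_integral_uniform_limit_circlepath[OF _ ul]
  have l1: "(\<lambda>z. \<Sum>t. f t z) contour_integrable_on circlepath 0 1"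
    by (rule lim(1)) (use int' in auto)
  have "(\<lambda>M. contour_integral (circlepath 0 1) (\<lambda>z. \<Sum>t<M. f t z)) \<longlonglongrightarrow>
          contour_integral (circlepath 0 1) (\<lambda>z. \<Sum>t. f t z)"
    by (rule lim(2)) (use int' in auto)
  \<comment> \<open>The integrals of the partial sums do not merely converge: they equal
    \<open>c n\<close> as soon as \<open>M > n\<close>.\<close>
  moreover have "\<forall>\<^sub>F M in sequentially. contour_integral (circlepath 0 1) (\<lambda>z. \<Sum>t<M. f t z) = c n"
    using eventually_gt_at_top[of n]
  proof eventually_elim
    case (elim M)
    then show ?case
      by (subst contour_integral_unique[OF int]) (simp add: of_bool_def if_distrib[of "\<lambda>x. _ * x"] sum.delta cong: if_cong)
  qed
  then have "(\<lambda>M. contour_integral (circlepath 0 1) (\<lambda>z. \<Sum>t<M. f t z)) \<longlonglongrightarrow> c n"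
    by (rule tendsto_eventually)
  ultimately have "contour_integral (circlepath 0 1) (\<lambda>z. \<Sum>t. f t z) = c n"
    using LIMSEQ_unique by blast
  with l1 have "((\<lambda>z. \<Sum>t. f t z) has_contour_integral c n) (circlepath 0 1)"
    using has_contour_integral_integral by fastforce
  then show ?thesis
  proof (rule has_contour_integral_eq)
    fix z :: complex assume "z \<in> path_image (circlepath 0 1)"
    then have z: "norm z = 1" by simp
    have "summable (\<lambda>t. c t * (1 / z ^ (t + 1)))"
      by (rule summable_norm_cancel) (use assms z in \<open>simp add: norm_mult norm_divide norm_power\<close>)
    then have "(\<Sum>t. z ^ n / (2 * of_real pi * \<i>) * (c t * (1 / z ^ (t + 1)))) =
        z ^ n / (2 * of_real pi * \<i>) * (\<Sum>t. c t * (1 / z ^ (t + 1)))"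
      by (rule suminf_mult)
    then show "(\<Sum>t. f t z) = z ^ n * (\<Sum>t. c t * (1 / z ^ (t + 1))) / (2 * of_real pi * \<i>)"
      by (simp add: f_def mult_ac)
  qed
qed

lemma circle_mean_power_series_poly:
  assumes "summable (\<lambda>t. norm (c t :: complex))"
    and "\<And>z. w z = (\<Sum>t. c t * (1 / z ^ (t + 1)))"
  shows "circle_mean (\<lambda>z. z ^ l * w z * poly P z) = (\<Sum>k\<le>degree P. coeff P k * c (k + l))"
  unfolding circle_mean_def
proof (rule contour_integral_unique)
  have "((\<lambda>z. \<Sum>k\<le>degree P. coeff P k * (z ^ (k + l) * (\<Sum>t. c t * (1 / z ^ (t + 1))) / (2 * of_real pi * \<i>)))
      has_contour_integral (\<Sum>k\<le>degree P. coeff P k * c (k + l))) (circlepath 0 1)"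
    by (intro has_contour_integral_sum has_contour_integral_lmul circlepath_integral_power_series assms) auto
  then show "((\<lambda>z. z ^ l * w z * poly P z / (2 * of_real pi * \<i>))
      has_contour_integral (\<Sum>k\<le>degree P. coeff P k * c (k + l))) (circlepath 0 1)"
    by (simp add: assms(2) poly_altdef power_add sum_distrib_left sum_divide_distrib mult_ac)
qed

section \<open>Convergence of the weight series\<close>

lemma summable_if_ratio_tendsto_0:
  fixes f :: "nat \<Rightarrow> 'a :: {banach, real_normed_div_algebra}"
  assumes "\<And>n. f (Suc n) = g n * f n" "g \<longlonglongrightarrow> 0"
  shows "summable (\<lambda>n. norm (f n))"
proof -
  from assms(2) have "\<forall>\<^sub>F n in sequentially. norm (g n) < 1 / 2"
    by (auto dest: tendstoD[of _ _ _ "1 / 2"] simp: dist_norm)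
  then obtain N where N: "\<And>n. n \<ge> N \<Longrightarrow> norm (g n) < 1 / 2"
    by (auto simp: eventually_sequentially)
  show ?thesis
  proof (rule summable_ratio_test[of "1 / 2" N])
    fix n assume "n \<ge> N"
    with N[of n] show "norm (norm (f (Suc n))) \<le> 1 / 2 * norm (norm (f n))"
      using mult_right_mono[of "norm (g n)" "1 / 2" "norm (f n)"] by (simp add: assms(1) norm_mult)
  qed simp
qed

text \<open>Dividing every factor by \<open>k\<close> makes it tend to 1; what remains is
  \<open>inverse k ^ (q - r)\<close>, with a positive exponent.\<close>

lemma ratio_shifted_products_tendsto_0:
  fixes u v :: "nat \<Rightarrow> complex"
  assumes "r < q"
  shows "(\<lambda>k. (\<Prod>\<rho>\<in>{1..r}. of_nat k + u \<rho>) / (\<Prod>h\<in>{1..q}. of_nat k + v h)) \<longlonglongrightarrow> 0"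
proof -
  have one: "(\<lambda>k. (of_nat k + c) / of_nat k) \<longlonglongrightarrow> 1" for c :: complex
  proof -
    have "(\<lambda>k. 1 + c * inverse (of_nat k)) \<longlonglongrightarrow> 1 + c * 0"
      by (intro tendsto_intros lim_inverse_n)
    then show ?thesis
      by (rule Lim_transform_eventually[THEN tendsto_eq_rhs])
         (auto simp: field_simps intro!: eventually_mono[OF eventually_gt_at_top[of 0]])
  qed
  have "(\<lambda>k. (\<Prod>\<rho>\<in>{1..r}. (of_nat k + u \<rho>) / of_nat k) / (\<Prod>h\<in>{1..q}. (of_nat k + v h) / of_nat k)
      * inverse (of_nat k) ^ (q - r)) \<longlonglongrightarrow> (\<Prod>\<rho>\<in>{1..r}. 1) / (\<Prod>h\<in>{1..q}. 1) * 0 ^ (q - r)"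
    by (intro tendsto_intros one lim_inverse_n) auto
  moreover have "\<forall>\<^sub>F k in sequentially. (\<Prod>\<rho>\<in>{1..r}. (of_nat k + u \<rho>) / of_nat k) / (\<Prod>h\<in>{1..q}. (of_nat k + v h) / of_nat k)
      * inverse (of_nat k) ^ (q - r) = (\<Prod>\<rho>\<in>{1..r}. of_nat k + u \<rho>) / (\<Prod>h\<in>{1..q}. of_nat k + v h)"
    using eventually_gt_at_top[of 0]
  proof eventually_elim
    case (elim k)
    have "(of_nat k :: complex) ^ q = of_nat k ^ r * of_nat k ^ (q - r)"
      using assms by (simp flip: power_add)
    with elim show ?case
      by (simp add: prod_dividef field_simps)
  qed
  ultimately show ?thesis
    using assms by (simp add: zero_power tendsto_cong)
qed

section \<open>Interpolation and Pochhammer symbols\<close>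

text \<open>Interpolation over an arbitrary finite index set, because nodes and poles are later
  indexed by pairs.\<close>

lemma poly_lagrange:
  fixes f :: "'a :: field poly"
  assumes "finite I" "inj_on x I" "degree f < card I"
  shows "f = (\<Sum>i\<in>I. smult (poly f (x i) / (\<Prod>j\<in>I - {i}. x i - x j)) (\<Prod>j\<in>I - {i}. [:- x j, 1:]))"
    (is "f = ?g")
proof (rule poly_eqI_degree)
  have deg: "degree (\<Prod>j\<in>I - {i}. [:- x j, 1:]) < card I" if "i \<in> I" for i
    using that assms(1,3) by (subst degree_prod_eq_sum_degree) auto
  have "degree ?g < card I"
    using assms deg by (intro degree_sum_less) (auto intro: le_less_trans[OF degree_smult_le])
  then show "degree ?g < card (x ` I)" and "degree f < card (x ` I)"
    using assms by (simp_all add: card_image)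
  fix y assume "y \<in> x ` I"
  then obtain k where k: "k \<in> I" "y = x k" by blast
  have "poly ?g y = (\<Sum>i\<in>I. if i = k then poly f y else 0)"
    unfolding poly_sum
  proof (rule sum.cong)
    fix i assume i: "i \<in> I"
    show "poly (smult (poly f (x i) / (\<Prod>j\<in>I - {i}. x i - x j)) (\<Prod>j\<in>I - {i}. [:- x j, 1:])) y
        = (if i = k then poly f y else 0)"
    proof (cases "i = k")
      case True
      have "(\<Prod>j\<in>I - {i}. x i - x j) \<noteq> 0"
        using assms(1,2) i by (auto simp: inj_on_def)
      with True k show ?thesis by (simp add: poly_prod)
    next
      case False
      then have "(\<Prod>j\<in>I - {i}. y - x j) = 0"
        using k assms(1) by (intro prod_zero) auto
      with False show ?thesis by (simp add: poly_prod)
    qed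
  qed simp
  then show "poly f y = poly ?g y" using k assms(1) by simp
qed

lemma poly_lagrange_eval:
  fixes f :: "'a :: field poly"
  assumes "finite I" "inj_on x I" "degree f < card I"
  shows "poly f y = (\<Sum>i\<in>I. poly f (x i) / (\<Prod>j\<in>I - {i}. x i - x j) * (\<Prod>j\<in>I - {i}. y - x j))"
  using arg_cong[OF poly_lagrange[OF assms], of "\<lambda>g. poly g y"] by (simp add: poly_sum poly_prod)

text \<open>The sum is the divided difference of \<open>f\<close>. The Lagrange basis polynomials
  without their denominators are monic of degree \<open>card I - 1\<close>, so the sum is the
  coefficient of \<open>f\<close> in that degree.\<close>

lemma divided_difference_eq_0:
  fixes f :: "'a :: field poly"
  assumes "finite I" "inj_on x I" "degree f + 1 < card I"
  shows "(\<Sum>i\<in>I. poly f (x i) / (\<Prod>j\<in>I - {i}. x i - x j)) = 0"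
proof -
  have 1: "coeff (\<Prod>j\<in>I - {i}. [:- x j, 1:]) (card I - 1) = 1" if "i \<in> I" for i
  proof -
    have "degree (\<Prod>j\<in>I - {i}. [:- x j, 1:]) = card I - 1"
      using that assms(1) by (subst degree_prod_eq_sum_degree) auto
    moreover have "lead_coeff (\<Prod>j\<in>I - {i}. [:- x j, 1:]) = 1"
      by (simp add: lead_coeff_prod)
    ultimately show ?thesis by simp
  qed
  have "0 = coeff f (card I - 1)"
    using assms by (intro coeff_eq_0[symmetric]) simp
  also have "\<dots> = (\<Sum>i\<in>I. poly f (x i) / (\<Prod>j\<in>I - {i}. x i - x j))"
    using assms 1 by (subst poly_lagrange[of I x]) (auto simp: coeff_sum intro!: sum.cong)
  finally show ?thesis by simp
qed

text \<open>The Pochhammer symbol of \<open>x + c\<close> as a polynomial in \<open>x\<close>, which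
  makes its degree available.\<close>

definition poch_poly :: "'a :: comm_semiring_1 \<Rightarrow> nat \<Rightarrow> 'a poly" where
  "poch_poly c k = (\<Prod>t<k. [:c + of_nat t, 1:])"

lemma poly_poch_poly: "poly (poch_poly c k) x = pochhammer (x + c) k"
  by (simp add: poch_poly_def poly_prod pochhammer_prod atLeast0LessThan add_ac)

lemma degree_poch_poly: "degree (poch_poly (c :: 'a :: idom) k) = k"
  unfolding poch_poly_def by (subst degree_prod_eq_sum_degree) auto

lemma pochhammer_eq_0_if_diff_less:
  fixes x :: "'a :: idom"
  assumes "x = - of_nat t" "t < k"
  shows "pochhammer x k = 0"
  using assms by (auto simp: pochhammer_prod intro: prod_zero)

lemma not_nonpos_Int_add_nat:
  fixes x :: "'a :: ring_char_0"
  assumes "x \<notin> \<int>\<^sub>\<le>\<^sub>0"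
  shows "x + of_nat k \<notin> \<int>\<^sub>\<le>\<^sub>0"
proof
  assume "x + of_nat k \<in> \<int>\<^sub>\<le>\<^sub>0"
  then obtain t where "x + of_nat k = - of_nat t" by (auto elim!: nonpos_Ints_cases')
  then have "x = - of_nat (t + k)" by (simp add: eq_diff_eq flip: diff_conv_add_uminus)
  with assms show False by (metis minus_of_nat_in_nonpos_Ints)
qed

text \<open>In terms of coefficients, neither the zero polynomial nor \<open>N = 0\<close> needs
  separate treatment.\<close>

lemma polys_le_iff: "P \<in> polys_le (int N - 1) \<longleftrightarrow> (\<forall>k\<ge>N. coeff P k = 0)"
proof
  assume "\<forall>k\<ge>N. coeff P k = 0"
  then have "P = 0 \<or> degree P < N"
    using leading_coeff_0_iff not_le by blast
  then show "P \<in> polys_le (int N - 1)" by (auto simp: polys_le_def)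
qed (auto simp: polys_le_def intro: coeff_eq_0)

lemma sum_lessThan_extend_zero:
  fixes f :: "nat \<Rightarrow> 'a :: comm_monoid_add"
  assumes "\<And>k. k \<ge> N \<Longrightarrow> f k = 0" "N \<le> M"
  shows "(\<Sum>k<M. f k) = (\<Sum>k<N. f k)"
  by (rule sum.mono_neutral_right) (use assms in auto)

section \<open>The rational functions and their independence\<close>

text \<open>\<open>near\<close> replaces the absolute value by a single inequality, which is
  available with \<open>j\<close> and \<open>h\<close> in either order.\<close>

locale hypergeometric_system =
  fixes p q r :: nat and a b \<kappa> :: "nat \<Rightarrow> complex" and n m :: "nat \<Rightarrow> nat"
  assumes p_pos: "1 \<le> p" and r_less: "r < q"
    and b_diff: "\<And>j h. j \<in> {1..q} \<Longrightarrow> h \<in> {1..q} \<Longrightarrow> j \<noteq> h \<Longrightarrow> b j - b h \<notin> \<int>"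
    and \<kappa>_diff: "\<And>i h. i \<in> {1..p} \<Longrightarrow> h \<in> {1..p} \<Longrightarrow> i \<noteq> h \<Longrightarrow> \<kappa> i - \<kappa> h \<notin> \<int>"
    and near: "\<And>j h. j \<in> {1..q} \<Longrightarrow> h \<in> {1..q} \<Longrightarrow> m j \<le> m h + 1"
    and \<kappa>a: "\<And>i \<rho>. i \<in> {1..p} \<Longrightarrow> \<rho> \<in> {1..r} \<Longrightarrow> \<kappa> i + a \<rho> + 1 \<notin> \<int>\<^sub>\<le>\<^sub>0"
    and \<kappa>b: "\<And>i j. i \<in> {1..p} \<Longrightarrow> j \<in> {1..q} \<Longrightarrow> \<kappa> i + b j + 1 \<notin> \<int>\<^sub>\<le>\<^sub>0"
    and ab: "\<And>j \<rho>. j \<in> {1..q} \<Longrightarrow> \<rho> \<in> {1..r} \<Longrightarrow> 1 \<le> m j \<Longrightarrow>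
               a \<rho> - b j - of_nat (m j) + 1 \<notin> \<int>\<^sub>\<le>\<^sub>0"
begin

text \<open>What is left of the moment of index \<open>k + l\<close> of the weight
  \<open>(j, i)\<close> after division by the Gamma quotient at \<open>x = \<kappa> i + k\<close>;
  it depends on \<open>i\<close> and \<open>k\<close> only through \<open>x\<close>.\<close>

definition ratfun :: "nat \<Rightarrow> nat \<Rightarrow> complex \<Rightarrow> complex" where
  "ratfun j l x = (\<Prod>\<rho>\<in>{1..r}. pochhammer (x + a \<rho> + 1) l) /
     ((\<Prod>h\<in>{1..q}. pochhammer (x + b h + 1) l) * (x + b j + 1 + of_nat l))"

definition denom :: "complex poly" where
  "denom = (\<Prod>h\<in>{1..q}. poch_poly (b h + 1) (m h))"

text \<open>The product \<open>denom * ratfun j l\<close> after cancellation: of the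
  \<open>m h\<close> factors of \<open>denom\<close> for index \<open>h\<close>, the function uses
  the first \<open>l\<close>, and one more if \<open>h = j\<close>.\<close>

definition numer :: "nat \<Rightarrow> nat \<Rightarrow> complex poly" where
  "numer j l = (\<Prod>\<rho>\<in>{1..r}. poch_poly (a \<rho> + 1) l) *
     (\<Prod>h\<in>{1..q}. poch_poly (b h + 1 + of_nat (l + of_bool (h = j))) (m h - (l + of_bool (h = j))))"

text \<open>From \<open>l < m j \<le> m h + 1\<close> follows \<open>l \<le> m h\<close>. So near
  the diagonal \<open>denom\<close> is a common denominator and the subtraction in
  \<open>numer\<close> does not truncate.\<close>

lemma shift_le_m: "j \<in> {1..q} \<Longrightarrow> l < m j \<Longrightarrow> h \<in> {1..q} \<Longrightarrow> l + of_bool (h = j) \<le> m h"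
  using near[of j h] by auto

lemma poly_denom: "poly denom x = (\<Prod>h\<in>{1..q}. pochhammer (x + b h + 1) (m h))"
  by (simp add: denom_def poly_prod poly_poch_poly add_ac)

lemma poly_numer:
  assumes "j \<in> {1..q}" "l < m j" "poly denom x \<noteq> 0"
  shows "poly (numer j l) x = poly denom x * ratfun j l x"
proof -
  let ?s = "\<lambda>h. l + of_bool (h = j)"
  have "poly denom x = (\<Prod>h\<in>{1..q}. pochhammer (x + b h + 1) (?s h) *
      pochhammer (x + b h + 1 + of_nat (?s h)) (m h - ?s h))"
    unfolding poly_denom by (intro prod.cong refl pochhammer_product shift_le_m assms)
  also have "\<dots> = (\<Prod>h\<in>{1..q}. pochhammer (x + b h + 1) (?s h)) *
      (\<Prod>h\<in>{1..q}. pochhammer (x + b h + 1 + of_nat (?s h)) (m h - ?s h))"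
    by (rule prod.distrib)
  also have "(\<Prod>h\<in>{1..q}. pochhammer (x + b h + 1) (?s h)) =
      (\<Prod>h\<in>{1..q}. pochhammer (x + b h + 1) l * (if h = j then x + b j + 1 + of_nat l else 1))"
    by (intro prod.cong) (auto simp: pochhammer_Suc)
  also have "\<dots> = (\<Prod>h\<in>{1..q}. pochhammer (x + b h + 1) l) * (x + b j + 1 + of_nat l)"
    using assms(1) by (simp add: prod.distrib)
  finally have eq: "poly denom x = (\<Prod>h\<in>{1..q}. pochhammer (x + b h + 1) l) * (x + b j + 1 + of_nat l) *
      (\<Prod>h\<in>{1..q}. pochhammer (x + b h + 1 + of_nat (?s h)) (m h - ?s h))" .
  with assms(3) have nz: "(\<Prod>h\<in>{1..q}. pochhammer (x + b h + 1) l) * (x + b j + 1 + of_nat l) \<noteq> 0"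
    by auto
  have "poly (numer j l) x = (\<Prod>\<rho>\<in>{1..r}. pochhammer (x + a \<rho> + 1) l) *
      (\<Prod>h\<in>{1..q}. pochhammer (x + b h + 1 + of_nat (?s h)) (m h - ?s h))"
    by (simp add: numer_def poly_prod poly_poch_poly add_ac)
  then show ?thesis
    unfolding ratfun_def eq using nz by (simp add: field_simps)
qed

text \<open>Of the \<open>|m|\<close> linear factors of \<open>denom\<close>,
  \<open>q * l + 1\<close> cancel and \<open>r * l\<close> new ones appear; \<open>r < q\<close>
  keeps the total below \<open>|m|\<close>.\<close>

lemma degree_numer:
  assumes "j \<in> {1..q}" "l < m j"
  shows "degree (numer j l) < sum m {1..q}"
proof -
  let ?s = "\<lambda>h. l + of_bool (h = j)"
  have "degree (numer j l) \<le> (\<Sum>\<rho>\<in>{1..r}. l) + (\<Sum>h\<in>{1..q}. m h - ?s h)"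
    unfolding numer_def
    by (intro degree_mult_le[THEN order_trans] add_mono degree_prod_sum_le[THEN order_trans] sum_mono)
       (simp_all add: degree_poch_poly)
  also have "(\<Sum>h\<in>{1..q}. m h - ?s h) = sum m {1..q} - (\<Sum>h\<in>{1..q}. ?s h)"
    using shift_le_m[OF assms] by (intro sum_subtractf_nat) auto
  also have "(\<Sum>h\<in>{1..q}. ?s h) = q * l + 1"
    using assms(1) by (simp add: sum.distrib)
  finally have "degree (numer j l) \<le> r * l + (sum m {1..q} - (q * l + 1))" by simp
  moreover have "r * l \<le> q * l" using r_less by simp
  moreover have "q * l + 1 \<le> sum m {1..q}"
    using sum_mono[of "{1..q}" ?s m] shift_le_m[OF assms] \<open>(\<Sum>h\<in>{1..q}. ?s h) = q * l + 1\<close> by simp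
  ultimately show ?thesis by linarith
qed

text \<open>The expression is the admissible quantity \<open>a \<rho> - b j - m j + 1\<close> plus
  the natural number \<open>m j - 1 - K + d\<close>. This keeps the denominators of the expansion
  coefficients away from 0.\<close>

lemma a_minus_b_neq:
  assumes "j \<in> {1..q}" "\<rho> \<in> {1..r}" "K < m j"
  shows "a \<rho> - (b j + of_nat K) + of_nat d \<noteq> 0"
proof
  assume "a \<rho> - (b j + of_nat K) + of_nat d = 0"
  then have "a \<rho> - b j - of_nat (m j) + 1 = - of_nat (m j - 1 - K + d)"
    using assms(3) by (simp add: of_nat_diff algebra_simps)
  with ab[of j \<rho>] assms show False by (metis less_one minus_of_nat_in_nonpos_Ints not_less not_less_zero)
qed

lemma b_diff_add_int_neq: "j \<in> {1..q} \<Longrightarrow> h \<in> {1..q} \<Longrightarrow> j \<noteq> h \<Longrightarrow> b j - b h + of_int k \<noteq> 0"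
  using b_diff[of j h] by (metis Ints_minus Ints_of_int add_eq_0_iff add.commute)

text \<open>The system is triangular: of the numerators with \<open>l' \<le> l\<close>, only \<open>numer j l\<close> does
  not vanish at the pole \<open>- b j - 1 - l\<close>.\<close>

lemma poly_numer_pole_neq_0:
  assumes "j \<in> {1..q}" "l < m j"
  shows "poly (numer j l) (- b j - 1 - of_nat l) \<noteq> 0"
proof -
  have "pochhammer (- b j - 1 - of_nat l + (a \<rho> + 1)) l \<noteq> 0" if "\<rho> \<in> {1..r}" for \<rho>
    using a_minus_b_neq[OF assms(1) that assms(2)]
    by (auto simp: pochhammer_prod algebra_simps)
  moreover have "pochhammer (- b j - 1 - of_nat l + (b h + 1 + of_nat (l + of_bool (h = j)))) k \<noteq> 0"
    if "h \<in> {1..q}" for h k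
  proof (cases "h = j")
    case True
    then show ?thesis by (simp flip: pochhammer_fact)
  next
    case False
    then show ?thesis
      using b_diff_add_int_neq[OF that assms(1) False, of "int t" for t]
      by (auto simp: pochhammer_prod algebra_simps)
  qed
  ultimately show ?thesis by (simp add: numer_def poly_prod poly_poch_poly)
qed

lemma poly_numer_pole_eq_0:
  assumes "j \<in> {1..q}" "l < m j" "j' \<in> {1..q}" "l' < m j'" "l' \<le> l" "(j', l') \<noteq> (j, l)"
  shows "poly (numer j' l') (- b j - 1 - of_nat l) = 0"
proof -
  let ?s = "l' + of_bool (j = j')"
  \<comment> \<open>If \<open>l' = l\<close>, the pairs differ in the first component, so no extra
    factor is removed at \<open>j\<close>. In all cases the factor of \<open>denom\<close> that
    vanishes at this pole is still present in \<open>numer j' l'\<close>.\<close>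
  have "?s \<le> l" using assms by (cases "l' = l") auto
  then have "pochhammer (- b j - 1 - of_nat l + (b j + 1 + of_nat ?s)) (m j - ?s) = 0"
    using assms(2) by (intro pochhammer_eq_0_if_diff_less[of _ "l - ?s"]) (auto simp: of_nat_diff)
  then have "(\<Prod>h\<in>{1..q}. pochhammer (- b j - 1 - of_nat l + (b h + 1 + of_nat (l' + of_bool (h = j'))))
      (m h - (l' + of_bool (h = j')))) = 0"
    by (intro prod_zero bexI[OF _ assms(1)]) simp_all
  then show ?thesis
    unfolding numer_def by (simp only: poly_mult poly_prod poly_poch_poly mult_zero_right)
qed

text \<open>Take the largest level \<open>l0\<close> that carries a nonzero coefficient, at some
  \<open>j0\<close>, and evaluate at the pole of \<open>(j0, l0)\<close>: by triangularity only this
  one term survives.\<close>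

lemma numer_independent:
  assumes "\<And>x. (\<Sum>j\<in>{1..q}. \<Sum>l<m j. c j l * poly (numer j l) x) = 0"
    and "j \<in> {1..q}" "l < m j"
  shows "c j l = 0"
proof (rule ccontr)
  assume "c j l \<noteq> 0"
  define L where "L = {l. \<exists>j\<in>{1..q}. l < m j \<and> c j l \<noteq> 0}"
  have "L \<subseteq> (\<Union>j\<in>{1..q}. {..<m j})" by (auto simp: L_def)
  then have "finite L" by (rule finite_subset) auto
  moreover have "l \<in> L" using assms \<open>c j l \<noteq> 0\<close> by (auto simp: L_def)
  ultimately obtain l0 where l0: "l0 \<in> L" "\<And>l. l \<in> L \<Longrightarrow> l \<le> l0"
    by (metis Max_ge Max_in empty_iff)
  then obtain j0 where j0: "j0 \<in> {1..q}" "l0 < m j0" "c j0 l0 \<noteq> 0" by (auto simp: L_def)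
  let ?x = "- b j0 - 1 - of_nat l0"
  have "c j l * poly (numer j l) ?x = (if j = j0 then if l = l0 then c j0 l0 * poly (numer j0 l0) ?x else 0 else 0)"
    if "j \<in> {1..q}" "l < m j" for j l
  proof (cases "c j l = 0")
    case False
    with that have "l \<le> l0" by (intro l0(2)) (auto simp: L_def)
    with poly_numer_pole_eq_0[OF j0(1,2) that] show ?thesis by auto
  qed (use j0 in auto)
  then have "(\<Sum>j\<in>{1..q}. \<Sum>l<m j. c j l * poly (numer j l) ?x) =
      (\<Sum>j\<in>{1..q}. \<Sum>l<m j. if j = j0 then if l = l0 then c j0 l0 * poly (numer j0 l0) ?x else 0 else 0)"
    by (intro sum.cong) auto
  also have "\<dots> = (\<Sum>j\<in>{1..q}. if j = j0 then c j0 l0 * poly (numer j0 l0) ?x else 0)"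
    using j0 by (intro sum.cong) (auto simp: sum.delta)
  also have "\<dots> = c j0 l0 * poly (numer j0 l0) ?x"
    using j0 by simp
  finally show False
    using assms(1) poly_numer_pole_neq_0[OF j0(1,2)] j0(3) by simp
qed

section \<open>Expansion of partial fractions\<close>

text \<open>The coefficient of \<open>1 / (b j - y)\<close> in the partial fraction decomposition in
  \<open>y\<close> of the product of the \<open>a \<rho> - y\<close> over the product of the
  \<open>b h - y\<close>.\<close>

definition residue_ratio :: "nat \<Rightarrow> complex" where
  "residue_ratio j = (\<Prod>\<rho>\<in>{1..r}. a \<rho> - b j) / (\<Prod>h\<in>{1..q} - {j}. b h - b j)"

lemma inj_on_b: "inj_on b {1..q}"
  using b_diff by (fastforce simp: inj_on_def)

text \<open>Lagrange interpolation at the points \<open>b j\<close> of a polynomial of degree at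
  most \<open>r < q\<close>. With denominators cleared it holds for every \<open>y\<close>.\<close>

lemma sum_residue_ratio:
  "(\<Sum>j\<in>{1..q}. residue_ratio j * (\<Prod>h\<in>{1..q} - {j}. b h - y)) = (\<Prod>\<rho>\<in>{1..r}. a \<rho> - y)"
proof -
  define f where "f = (\<Prod>\<rho>\<in>{1..r}. [:a \<rho>, -1:])"
  have f: "poly f x = (\<Prod>\<rho>\<in>{1..r}. a \<rho> - x)" for x
    by (simp add: f_def poly_prod)
  have "degree f \<le> r"
    unfolding f_def by (rule degree_prod_sum_le[THEN order_trans]) auto
  then have "poly f y = (\<Sum>j\<in>{1..q}. poly f (b j) / (\<Prod>h\<in>{1..q} - {j}. b j - b h) * (\<Prod>h\<in>{1..q} - {j}. y - b h))"
    using r_less by (intro poly_lagrange_eval inj_on_b) auto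
  also have "\<dots> = (\<Sum>j\<in>{1..q}. poly f (b j) * (\<Prod>h\<in>{1..q} - {j}. (y - b h) / (b j - b h)))"
    by (simp add: prod_dividef)
  also have "\<dots> = (\<Sum>j\<in>{1..q}. poly f (b j) * (\<Prod>h\<in>{1..q} - {j}. (b h - y) / (b h - b j)))"
    by (intro sum.cong prod.cong arg_cong2[of _ _ _ _ "(*)"] refl) (metis minus_diff_eq minus_divide_divide)
  finally show ?thesis
    by (simp add: f residue_ratio_def prod_dividef)
qed

text \<open>The decomposition at \<open>y2\<close>, multiplied by the product of the
  \<open>b h - y1\<close>, is subtracted from the cleared decomposition at \<open>y1\<close>. In
  each summand \<open>(b j - y2) - (b j - y1) = y1 - y2\<close> comes out as a factor.\<close>

lemma two_point_identity:
  assumes "\<And>h. h \<in> {1..q} \<Longrightarrow> b h - y2 \<noteq> 0"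
  shows "(y1 - y2) * (\<Sum>j\<in>{1..q}. residue_ratio j * (\<Prod>h\<in>{1..q} - {j}. b h - y1) / (b j - y2)) =
    (\<Prod>\<rho>\<in>{1..r}. a \<rho> - y1) -
    (\<Prod>h\<in>{1..q}. b h - y1) * (\<Prod>\<rho>\<in>{1..r}. a \<rho> - y2) / (\<Prod>h\<in>{1..q}. b h - y2)"
proof -
  let ?P = "\<lambda>j y. \<Prod>h\<in>{1..q} - {j}. b h - y"
  have split: "(\<Prod>h\<in>{1..q}. b h - y) = (b j - y) * ?P j y" if "j \<in> {1..q}" for j y
    using that by (intro prod.remove) auto
  have "(\<Prod>\<rho>\<in>{1..r}. a \<rho> - y2) / (\<Prod>h\<in>{1..q}. b h - y2) =
      (\<Sum>j\<in>{1..q}. residue_ratio j / (b j - y2))"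
    unfolding sum_residue_ratio[symmetric] sum_divide_distrib
  proof (intro sum.cong refl)
    fix j assume j: "j \<in> {1..q}"
    have "?P j y2 \<noteq> 0" using assms by auto
    then show "residue_ratio j * ?P j y2 / (\<Prod>h\<in>{1..q}. b h - y2) = residue_ratio j / (b j - y2)"
      unfolding split[OF j] by simp
  qed
  then have "(\<Prod>h\<in>{1..q}. b h - y1) * (\<Prod>\<rho>\<in>{1..r}. a \<rho> - y2) / (\<Prod>h\<in>{1..q}. b h - y2) =
      (\<Sum>j\<in>{1..q}. (\<Prod>h\<in>{1..q}. b h - y1) * (residue_ratio j / (b j - y2)))"
    by (simp only: times_divide_eq_right[symmetric] sum_distrib_left)
  also have "\<dots> = (\<Sum>j\<in>{1..q}. (b j - y1) * (residue_ratio j * ?P j y1 / (b j - y2)))"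
    by (intro sum.cong refl) (subst split, auto)
  finally have "(\<Prod>\<rho>\<in>{1..r}. a \<rho> - y1) -
    (\<Prod>h\<in>{1..q}. b h - y1) * (\<Prod>\<rho>\<in>{1..r}. a \<rho> - y2) / (\<Prod>h\<in>{1..q}. b h - y2) =
    (\<Sum>j\<in>{1..q}. residue_ratio j * ?P j y1 - (b j - y1) * (residue_ratio j * ?P j y1 / (b j - y2)))"
    by (simp only: sum_residue_ratio sum_subtractf times_divide_eq_right)
  also have "\<dots> = (\<Sum>j\<in>{1..q}. (y1 - y2) * (residue_ratio j * ?P j y1 / (b j - y2)))"
  proof (intro sum.cong refl)
    fix j assume "j \<in> {1..q}"
    then have "b j - y2 \<noteq> 0" by (rule assms)
    then have "X - (b j - y1) * (X / (b j - y2)) = ((b j - y2) - (b j - y1)) * (X / (b j - y2))" for X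
      by (simp add: divide_simps) (simp add: algebra_simps)
    then show "residue_ratio j * ?P j y1 - (b j - y1) * (residue_ratio j * ?P j y1 / (b j - y2)) =
        (y1 - y2) * (residue_ratio j * ?P j y1 / (b j - y2))"
      by simp
  qed
  finally show ?thesis by (simp add: sum_distrib_left)
qed

text \<open>The coefficients of the partial fraction \<open>1 / (x + b H + K + 1)\<close> in the basis \<open>ratfun\<close>.\<close>

definition pf_coeff :: "nat \<Rightarrow> nat \<Rightarrow> nat \<Rightarrow> nat \<Rightarrow> complex" where
  "pf_coeff H K j d = residue_ratio j *
     ((\<Prod>h\<in>{1..q} - {j}. b h - (b H + of_nat K)) / (\<Prod>\<rho>\<in>{1..r}. a \<rho> - (b H + of_nat K))) *
     ((\<Prod>h\<in>{1..q}. pochhammer (b h - (b H + of_nat K) + 1 - of_bool (h = j)) d) /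
      (\<Prod>\<rho>\<in>{1..r}. pochhammer (a \<rho> - (b H + of_nat K) + 1) d))"

lemma pf_coeff_eq_0:
  assumes "H \<in> {1..q}" "K + of_bool (j = H) \<le> d"
  shows "pf_coeff H K j d = 0"
\<comment> \<open>For \<open>K = 0\<close> and \<open>j \<noteq> H\<close> the Pochhammer symbol of
  index \<open>H\<close> starts at 1 and never vanishes; the factor \<open>b H - (b H + 0)\<close>
  of the first product does. Otherwise that symbol starts at \<open>- K\<close> or
  \<open>1 - K\<close> and terminates.\<close>
proof (cases "K = 0 \<and> j \<noteq> H")
  case True
  then have "(\<Prod>h\<in>{1..q} - {j}. b h - (b H + of_nat K)) = 0"
    using assms(1) by (intro prod_zero) auto
  then show ?thesis by (simp add: pf_coeff_def)
next
  case False
  have "pochhammer (b H - (b H + of_nat K) + 1 - of_bool (H = j)) d = (0 :: complex)"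
  proof (cases "j = H")
    case True
    with assms(2) show ?thesis
      by (intro pochhammer_eq_0_if_diff_less[of _ K]) auto
  next
    case j: False
    with False obtain k where "K = Suc k" by (cases K) auto
    with j assms(2) show ?thesis
      by (intro pochhammer_eq_0_if_diff_less[of _ k]) auto
  qed
  then have "(\<Prod>h\<in>{1..q}. pochhammer (b h - (b H + of_nat K) + 1 - of_bool (h = j)) d) = 0"
    by (intro prod_zero bexI[OF _ assms(1)]) simp_all
  then show ?thesis by (simp add: pf_coeff_def)
qed

text \<open>All shifts are excluded, not only the zeros of \<open>denom\<close>, so that no
  denominator of any \<open>ratfun j l\<close> vanishes; every \<open>\<kappa> i + k\<close>
  qualifies.\<close>

definition regular_point :: "complex \<Rightarrow> bool" where
  "regular_point x \<longleftrightarrow> (\<forall>h\<in>{1..q}. x + b h + 1 \<notin> \<int>\<^sub>\<le>\<^sub>0)"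

lemma regular_pointD: "regular_point x \<Longrightarrow> h \<in> {1..q} \<Longrightarrow> x + b h + 1 + of_nat t \<noteq> 0"
  by (metis regular_point_def not_nonpos_Int_add_nat zero_in_nonpos_Ints)

lemma regular_point_pochhammer: "regular_point x \<Longrightarrow> h \<in> {1..q} \<Longrightarrow> pochhammer (x + b h + 1) t \<noteq> 0"
  using pochhammer_eq_0_imp_nonpos_Int regular_point_def by blast

lemma regular_point_denom: "regular_point x \<Longrightarrow> poly denom x \<noteq> 0"
  using regular_point_pochhammer by (auto simp: poly_denom)

text \<open>For fixed \<open>d\<close>, the sum over \<open>j\<close> is
  \<open>F d - F (Suc d)\<close> divided by \<open>x + b H + 1 + K\<close>, a divisor free of
  \<open>d\<close>. The sum over \<open>d\<close> therefore telescopes, from \<open>F 0 = 1\<close>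
  down to \<open>F (Suc K) = 0\<close>.\<close>

lemma partial_fraction_expansion:
  assumes H: "H \<in> {1..q}" and K: "K < m H" and x: "regular_point x"
  shows "(\<Sum>j\<in>{1..q}. \<Sum>d<m j. pf_coeff H K j d * ratfun j d x) = 1 / (x + b H + 1 + of_nat K)"
proof -
  define \<beta> where "\<beta> = b H + of_nat K"
  define F where "F = (\<lambda>d. (\<Prod>h\<in>{1..q}. pochhammer (b h - \<beta>) d) * (\<Prod>\<rho>\<in>{1..r}. pochhammer (x + a \<rho> + 1) d) /
     ((\<Prod>\<rho>\<in>{1..r}. pochhammer (a \<rho> - \<beta>) d) * (\<Prod>h\<in>{1..q}. pochhammer (x + b h + 1) d)))"
  have xb: "x + b H + 1 + of_nat K \<noteq> 0" using regular_pointD[OF x H] .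
  have a_nz: "a \<rho> - \<beta> + of_nat d \<noteq> 0" if "\<rho> \<in> {1..r}" for \<rho> d
    using a_minus_b_neq[OF H that K] by (simp add: \<beta>_def)
  have pa_nz: "pochhammer (a \<rho> - \<beta>) d \<noteq> 0" if "\<rho> \<in> {1..r}" for \<rho> d
    using a_nz[OF that] by (simp add: pochhammer_prod)
  have step: "(\<Sum>j\<in>{1..q}. pf_coeff H K j d * ratfun j d x) = (F d - F (Suc d)) / (x + b H + 1 + of_nat K)" for d
  proof -
    define PB where "PB = (\<Prod>h\<in>{1..q}. pochhammer (b h - \<beta>) d)"
    define PA where "PA = (\<Prod>\<rho>\<in>{1..r}. pochhammer (a \<rho> - \<beta>) d)"
    define XA where "XA = (\<Prod>\<rho>\<in>{1..r}. pochhammer (x + a \<rho> + 1) d)"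
    define XB where "XB = (\<Prod>h\<in>{1..q}. pochhammer (x + b h + 1) d)"
    \<comment> \<open>Chosen so that \<open>c - y1\<close> and \<open>c - y2\<close> are the factors
      of index \<open>d\<close> in the Pochhammer symbols starting at \<open>c - \<beta>\<close> and
      \<open>x + c + 1\<close>, while \<open>y1 - y2\<close> does not depend on
      \<open>d\<close>.\<close>
    define y1 where "y1 = \<beta> - of_nat d"
    define y2 where "y2 = - (x + 1 + of_nat d)"
    define QA where "QA = (\<Prod>\<rho>\<in>{1..r}. a \<rho> - \<beta> + of_nat d)"
    define QB where "QB = (\<Prod>h\<in>{1..q}. b h - \<beta> + of_nat d)"
    define YA where "YA = (\<Prod>\<rho>\<in>{1..r}. x + a \<rho> + 1 + of_nat d)"
    define YB where "YB = (\<Prod>h\<in>{1..q}. x + b h + 1 + of_nat d)"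
    have y: "c - y1 = c - \<beta> + of_nat d" "c - y2 = x + c + 1 + of_nat d" for c
      by (simp_all add: y1_def y2_def)
    have nz: "PA \<noteq> 0" "XB \<noteq> 0" "QA \<noteq> 0" "YB \<noteq> 0"
      using pa_nz a_nz regular_point_pochhammer[OF x] regular_pointD[OF x]
      by (auto simp: PA_def XB_def QA_def YB_def)
    have F: "F d = PB * XA / (PA * XB)"
      by (simp add: F_def PB_def PA_def XA_def XB_def)
    have F': "F (Suc d) = PB * QB * (XA * YA) / (PA * QA * (XB * YB))"
      by (simp add: F_def PB_def PA_def XA_def XB_def QA_def QB_def YA_def YB_def
          pochhammer_Suc prod.distrib mult_ac)
    have summand: "pf_coeff H K j d * ratfun j d x =
        PB * XA / (PA * XB * QA) * (residue_ratio j * (\<Prod>h\<in>{1..q} - {j}. b h - y1) / (b j - y2))"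
      if j: "j \<in> {1..q}" for j
    proof -
      \<comment> \<open>For \<open>h = j\<close> the symbol already starts at
        \<open>b j - \<beta>\<close>. For the others the factors \<open>b h - \<beta>\<close> are
        absorbed as first factors, and then the last factors \<open>b h - y1\<close> are split
        off.\<close>
      have "(\<Prod>h\<in>{1..q}. pochhammer (b h - \<beta> + 1 - of_bool (h = j)) d) =
          pochhammer (b j - \<beta>) d * (\<Prod>h\<in>{1..q} - {j}. pochhammer (b h - \<beta> + 1) d)"
        using j by (subst prod.remove[of _ j]) (auto intro!: prod.cong)
      then have "(\<Prod>h\<in>{1..q} - {j}. b h - \<beta>) * (\<Prod>h\<in>{1..q}. pochhammer (b h - \<beta> + 1 - of_bool (h = j)) d) =
          pochhammer (b j - \<beta>) d * (\<Prod>h\<in>{1..q} - {j}. pochhammer (b h - \<beta>) (Suc d))"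
        by (simp add: pochhammer_rec prod.distrib)
      also have "\<dots> = PB * (\<Prod>h\<in>{1..q} - {j}. b h - y1)"
        using j unfolding PB_def
        by (subst prod.remove[of "{1..q}" j]) (simp_all add: pochhammer_Suc prod.distrib y mult_ac)
      finally have num: "(\<Prod>h\<in>{1..q} - {j}. b h - \<beta>) *
          (\<Prod>h\<in>{1..q}. pochhammer (b h - \<beta> + 1 - of_bool (h = j)) d) = PB * (\<Prod>h\<in>{1..q} - {j}. b h - y1)" .
      have "(\<Prod>\<rho>\<in>{1..r}. a \<rho> - \<beta>) * (\<Prod>\<rho>\<in>{1..r}. pochhammer (a \<rho> - \<beta> + 1) d) =
          (\<Prod>\<rho>\<in>{1..r}. pochhammer (a \<rho> - \<beta>) (Suc d))"
        by (simp add: pochhammer_rec prod.distrib)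
      also have "\<dots> = PA * QA"
        by (simp add: PA_def QA_def pochhammer_Suc prod.distrib)
      finally have den: "(\<Prod>\<rho>\<in>{1..r}. a \<rho> - \<beta>) * (\<Prod>\<rho>\<in>{1..r}. pochhammer (a \<rho> - \<beta> + 1) d) = PA * QA" .
      have "pf_coeff H K j d = residue_ratio j * (PB * (\<Prod>h\<in>{1..q} - {j}. b h - y1)) / (PA * QA)"
        unfolding pf_coeff_def \<beta>_def[symmetric] num[symmetric] den[symmetric] by simp
      moreover have "ratfun j d x = XA / (XB * (b j - y2))"
        by (simp add: ratfun_def XA_def XB_def y)
      ultimately show ?thesis by (simp add: mult_ac)
    qed
    have y12: "y1 - y2 = x + b H + 1 + of_nat K" by (simp add: y1_def y2_def \<beta>_def)
    have "(\<Sum>j\<in>{1..q}. pf_coeff H K j d * ratfun j d x) = PB * XA / (PA * XB * QA) *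
        (\<Sum>j\<in>{1..q}. residue_ratio j * (\<Prod>h\<in>{1..q} - {j}. b h - y1) / (b j - y2))" (is "_ = _ * ?S")
      unfolding sum_distrib_left by (intro sum.cong summand refl)
    also have "?S = (QA - QB * YA / YB) / (x + b H + 1 + of_nat K)"
    proof -
      have "(y1 - y2) * ?S = QA - QB * YA / YB"
        unfolding QA_def QB_def YA_def YB_def y[symmetric]
        by (rule two_point_identity) (use regular_pointD[OF x] in \<open>simp add: y\<close>)
      from this[symmetric, unfolded y12] show ?thesis
        using xb by (simp only: nonzero_mult_div_cancel_left[OF xb])
    qed
    also have "PB * XA / (PA * XB * QA) * ((QA - QB * YA / YB) / (x + b H + 1 + of_nat K)) =
        (F d - F (Suc d)) / (x + b H + 1 + of_nat K)"
    proof -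
      have "PB * XA / (PA * XB * QA) * QA = F d"
        unfolding F using nz by (simp add: divide_simps)
      moreover have "PB * XA / (PA * XB * QA) * (QB * YA / YB) = F (Suc d)"
        unfolding F' times_divide_times_eq by (simp only: mult_ac)
      ultimately show ?thesis by (simp only: times_divide_eq_right right_diff_distrib)
    qed
    finally show ?thesis .
  qed
  have "(\<Sum>j\<in>{1..q}. \<Sum>d<m j. pf_coeff H K j d * ratfun j d x) =
      (\<Sum>j\<in>{1..q}. \<Sum>d<Suc K. pf_coeff H K j d * ratfun j d x)"
  proof (rule sum.cong[OF refl])
    fix j assume j: "j \<in> {1..q}"
    \<comment> \<open>Coefficients vanish from \<open>d = K + of_bool (j = H)\<close> on, and near
      the diagonal both \<open>m j\<close> and \<open>Suc K\<close> reach that far. Hence the range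
      can be made independent of \<open>j\<close>.\<close>
    have "K + of_bool (j = H) \<le> m j" using near[OF H j] K by auto
    then show "(\<Sum>d<m j. pf_coeff H K j d * ratfun j d x) = (\<Sum>d<Suc K. pf_coeff H K j d * ratfun j d x)"
      by (intro trans[OF sum_lessThan_extend_zero sum_lessThan_extend_zero[symmetric]])
         (auto intro: pf_coeff_eq_0[OF H])
  qed
  also have "\<dots> = (\<Sum>d<Suc K. \<Sum>j\<in>{1..q}. pf_coeff H K j d * ratfun j d x)"
    by (rule sum.swap)
  also have "\<dots> = (F 0 - F (Suc K)) / (x + b H + 1 + of_nat K)"
    unfolding sum_lessThan_telescope'[symmetric] sum_divide_distrib by (rule sum.cong[OF refl step])
  also have "F (Suc K) = 0"
  proof -
    have "pochhammer (b H - \<beta>) (Suc K) = 0"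
      by (rule pochhammer_eq_0_if_diff_less[of _ K]) (auto simp: \<beta>_def)
    then have "(\<Prod>h\<in>{1..q}. pochhammer (b h - \<beta>) (Suc K)) = 0"
      by (intro prod_zero bexI[OF _ H]) simp_all
    then show ?thesis by (simp add: F_def)
  qed
  also have "F 0 = 1" by (simp add: F_def)
  finally show ?thesis by (simp only: diff_zero)
qed

end

section \<open>The problems as linear systems\<close>

lemma Gamma_add_of_nat:
  fixes z :: complex
  assumes "z \<notin> \<int>\<^sub>\<le>\<^sub>0"
  shows "Gamma (z + of_nat k) = Gamma z * pochhammer z k"
  using pochhammer_Gamma[OF assms, of k] assms by (simp add: Gamma_eq_zero_iff)

lemma sum_coeff_le_degree:
  fixes P :: "'a :: comm_semiring_0 poly"
  assumes "\<forall>k\<ge>N. coeff P k = 0"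
  shows "(\<Sum>k\<le>degree P. coeff P k * g k) = (\<Sum>k<N. coeff P k * g k)"
proof -
  have "(\<Sum>k\<le>degree P. coeff P k * g k) = (\<Sum>k\<in>{..degree P} \<union> {..<N}. coeff P k * g k)"
    by (rule sum.mono_neutral_left) (auto simp: coeff_eq_0)
  also have "\<dots> = (\<Sum>k<N. coeff P k * g k)"
    by (rule sum.mono_neutral_right) (use assms in auto)
  finally show ?thesis .
qed

context hypergeometric_system
begin

definition gamma_quot :: "complex \<Rightarrow> complex" where
  "gamma_quot x = (\<Prod>\<rho>\<in>{1..r}. Gamma (x + a \<rho> + 1)) / (\<Prod>h\<in>{1..q}. Gamma (x + b h + 1))"

lemma regular_point_node: "i \<in> {1..p} \<Longrightarrow> regular_point (\<kappa> i + of_nat k)"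
  unfolding regular_point_def using \<kappa>b[of i] not_nonpos_Int_add_nat[of "\<kappa> i + b h + 1" k for h]
  by (simp add: add_ac)

lemma node_a: "i \<in> {1..p} \<Longrightarrow> \<rho> \<in> {1..r} \<Longrightarrow> \<kappa> i + of_nat k + a \<rho> + 1 \<notin> \<int>\<^sub>\<le>\<^sub>0"
  using not_nonpos_Int_add_nat[OF \<kappa>a[of i \<rho>], of k] by (simp add: add_ac)

lemma node_b: "i \<in> {1..p} \<Longrightarrow> h \<in> {1..q} \<Longrightarrow> \<kappa> i + of_nat k + b h + 1 \<notin> \<int>\<^sub>\<le>\<^sub>0"
  using regular_point_node by (simp add: regular_point_def)

lemma gamma_quot_neq_0: "i \<in> {1..p} \<Longrightarrow> gamma_quot (\<kappa> i + of_nat k) \<noteq> 0"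
  using node_a[of i _ k] node_b[of i _ k] by (auto simp: gamma_quot_def Gamma_eq_zero_iff)

text \<open>Written exactly like the series coefficient in \<open>weight\<close>, so that unfolding
  both definitions identifies them.\<close>

definition moment :: "nat \<Rightarrow> nat \<Rightarrow> nat \<Rightarrow> complex" where
  "moment i j t = (\<Prod>\<rho>\<in>{1..r}. Gamma (of_nat t + \<kappa> i + a \<rho> + 1)) /
     (\<Prod>h\<in>{1..q}. Gamma (of_nat t + \<kappa> i + b h + of_bool (h = j) + 1))"

text \<open>By \<open>Gamma (z + l) = Gamma z * pochhammer z l\<close>. The split of
  \<open>k + l\<close> can be read either way: problem (A) takes the coefficient index as the shift
  of the node, problem (B) the exponent of \<open>z\<close>.\<close>

lemma moment_add:
  assumes "i \<in> {1..p}" "j \<in> {1..q}"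
  shows "moment i j (k + l) = gamma_quot (\<kappa> i + of_nat k) * ratfun j l (\<kappa> i + of_nat k)"
proof -
  let ?x = "\<kappa> i + of_nat k"
  have "(\<Prod>\<rho>\<in>{1..r}. Gamma (of_nat (k + l) + \<kappa> i + a \<rho> + 1)) =
      (\<Prod>\<rho>\<in>{1..r}. Gamma (?x + a \<rho> + 1) * pochhammer (?x + a \<rho> + 1) l)"
    by (intro prod.cong refl, subst Gamma_add_of_nat[OF node_a[OF assms(1)], symmetric]) (auto simp: add_ac)
  moreover have "(\<Prod>h\<in>{1..q}. Gamma (of_nat (k + l) + \<kappa> i + b h + of_bool (h = j) + 1)) =
      (\<Prod>h\<in>{1..q}. Gamma (?x + b h + 1) * pochhammer (?x + b h + 1) (l + of_bool (h = j)))"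
    by (intro prod.cong refl, subst Gamma_add_of_nat[OF node_b[OF assms(1)], symmetric]) (auto simp: add_ac)
  moreover have "(\<Prod>h\<in>{1..q}. pochhammer (?x + b h + 1) (l + of_bool (h = j))) =
      (\<Prod>h\<in>{1..q}. pochhammer (?x + b h + 1) l * (if h = j then ?x + b j + 1 + of_nat l else 1))"
    by (intro prod.cong) (auto simp: pochhammer_Suc)
  ultimately show ?thesis
    using assms(2) by (simp add: moment_def gamma_quot_def ratfun_def prod.distrib)
qed

lemma summable_moment:
  assumes "i \<in> {1..p}" "j \<in> {1..q}"
  shows "summable (\<lambda>t. norm (moment i j t))"
proof (rule summable_if_ratio_tendsto_0)
  show "(\<lambda>t. (\<Prod>\<rho>\<in>{1..r}. of_nat t + (\<kappa> i + a \<rho> + 1)) /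
      (\<Prod>h\<in>{1..q}. of_nat t + (\<kappa> i + b h + of_bool (h = j) + 1))) \<longlonglongrightarrow> 0"
    by (rule ratio_shifted_products_tendsto_0[OF r_less])
  fix t
  have "Gamma (of_nat (Suc t) + \<kappa> i + a \<rho> + 1) =
      (of_nat t + (\<kappa> i + a \<rho> + 1)) * Gamma (of_nat t + \<kappa> i + a \<rho> + 1)" if "\<rho> \<in> {1..r}" for \<rho>
    using Gamma_add_of_nat[OF node_a[OF assms(1) that], of t 1] by (simp add: add_ac mult_ac)
  moreover have "Gamma (of_nat (Suc t) + \<kappa> i + b h + of_bool (h = j) + 1) =
      (of_nat t + (\<kappa> i + b h + of_bool (h = j) + 1)) * Gamma (of_nat t + \<kappa> i + b h + of_bool (h = j) + 1)"
    if "h \<in> {1..q}" for h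
    using Gamma_add_of_nat[OF node_b[OF assms(1) that], of "t + of_bool (h = j)" 1] by (simp add: add_ac mult_ac)
  ultimately show "moment i j (Suc t) = (\<Prod>\<rho>\<in>{1..r}. of_nat t + (\<kappa> i + a \<rho> + 1)) /
      (\<Prod>h\<in>{1..q}. of_nat t + (\<kappa> i + b h + of_bool (h = j) + 1)) * moment i j t"
    by (simp add: moment_def prod.distrib)
qed

lemma circle_mean_weight:
  assumes "i \<in> {1..p}" "j \<in> {1..q}" "\<forall>k\<ge>N. coeff P k = 0"
  shows "circle_mean (\<lambda>z. z ^ l * weight q r a b \<kappa> j i z * poly P z) = (\<Sum>k<N. coeff P k * moment i j (k + l))"
proof -
  have "circle_mean (\<lambda>z. z ^ l * weight q r a b \<kappa> j i z * poly P z) =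
      (\<Sum>k\<le>degree P. coeff P k * moment i j (k + l))"
    by (rule circle_mean_power_series_poly)
       (use summable_moment[OF assms(1,2)] in \<open>simp_all add: weight_def moment_def\<close>)
  then show ?thesis using sum_coeff_le_degree[OF assms(3)] by simp
qed

lemma solutions_A_iff:
  "P \<in> solutions_A p q r a b \<kappa> n m \<longleftrightarrow>
     (\<forall>i\<in>{1..p}. \<forall>k\<ge>n i. coeff (P i) k = 0) \<and> (\<forall>i. i \<notin> {1..p} \<longrightarrow> P i = 0) \<and>
     (\<forall>j\<in>{1..q}. \<forall>l<m j. (\<Sum>i\<in>{1..p}. \<Sum>k<n i.
        coeff (P i) k * gamma_quot (\<kappa> i + of_nat k) * ratfun j l (\<kappa> i + of_nat k)) = 0)"
proof -
  have "(\<Sum>i\<in>{1..p}. circle_mean (\<lambda>z. z ^ l * weight q r a b \<kappa> j i z * poly (P i) z)) =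
      (\<Sum>i\<in>{1..p}. \<Sum>k<n i. coeff (P i) k * gamma_quot (\<kappa> i + of_nat k) * ratfun j l (\<kappa> i + of_nat k))"
    if "\<forall>i\<in>{1..p}. \<forall>k\<ge>n i. coeff (P i) k = 0" "j \<in> {1..q}" for j l
    using that by (intro sum.cong refl, subst circle_mean_weight) (auto simp: moment_add mult_ac)
  then show ?thesis
    unfolding solutions_A_def polys_le_iff by auto
qed

text \<open>Dual to (A): the coefficient index of \<open>Q j\<close> now selects the function and
  the exponent \<open>l\<close> the node. The Gamma quotient is then common to the whole sum and,
  being nonzero, drops out.\<close>

lemma solutions_B_iff:
  "Q \<in> solutions_B p q r a b \<kappa> n m \<longleftrightarrow>
     (\<forall>j\<in>{1..q}. \<forall>k\<ge>m j. coeff (Q j) k = 0) \<and> (\<forall>j. j \<notin> {1..q} \<longrightarrow> Q j = 0) \<and>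
     (\<forall>i\<in>{1..p}. \<forall>l<n i. (\<Sum>j\<in>{1..q}. \<Sum>k<m j. coeff (Q j) k * ratfun j k (\<kappa> i + of_nat l)) = 0)"
proof -
  have "(\<Sum>j\<in>{1..q}. circle_mean (\<lambda>z. z ^ l * poly (Q j) z * weight q r a b \<kappa> j i z)) =
      gamma_quot (\<kappa> i + of_nat l) * (\<Sum>j\<in>{1..q}. \<Sum>k<m j. coeff (Q j) k * ratfun j k (\<kappa> i + of_nat l))"
    if "\<forall>j\<in>{1..q}. \<forall>k\<ge>m j. coeff (Q j) k = 0" "i \<in> {1..p}" for i l
    unfolding sum_distrib_left
  proof (rule sum.cong[OF refl])
    fix j assume j: "j \<in> {1..q}"
    have "circle_mean (\<lambda>z. z ^ l * poly (Q j) z * weight q r a b \<kappa> j i z) =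
        circle_mean (\<lambda>z. z ^ l * weight q r a b \<kappa> j i z * poly (Q j) z)"
      by (simp only: mult_ac)
    also have "\<dots> = (\<Sum>k<m j. coeff (Q j) k * moment i j (l + k))"
      using that j by (subst circle_mean_weight) (auto simp: add.commute)
    also have "\<dots> = (\<Sum>k<m j. gamma_quot (\<kappa> i + of_nat l) * (coeff (Q j) k * ratfun j k (\<kappa> i + of_nat l)))"
      using that j by (simp add: moment_add mult_ac)
    finally show "circle_mean (\<lambda>z. z ^ l * poly (Q j) z * weight q r a b \<kappa> j i z) =
        (\<Sum>k<m j. gamma_quot (\<kappa> i + of_nat l) * (coeff (Q j) k * ratfun j k (\<kappa> i + of_nat l)))" .
  qed
  then show ?thesis
    unfolding solutions_B_def polys_le_iff by (auto simp: gamma_quot_neq_0)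
qed

text \<open>For \<open>K = 0\<close> the partial fraction is \<open>ratfun H 0\<close> itself; this
  is why the constant \<open>pi_B\<close> term stands apart in \<open>vec_B\<close>.\<close>

lemma pf_coeff_0:
  assumes "H \<in> {1..q}" "0 < m H"
  shows "pf_coeff H 0 j d = of_bool (j = H \<and> d = 0)"
proof (cases "j = H \<and> d = 0")
  case True
  have "(\<Prod>\<rho>\<in>{1..r}. a \<rho> - b H) \<noteq> 0"
    using a_minus_b_neq[OF assms(1) _ assms(2), of _ 0] by auto
  moreover have "(\<Prod>h\<in>{1..q} - {H}. b h - b H) \<noteq> 0"
    using b_diff_add_int_neq[OF _ assms(1), of _ 0] by auto
  ultimately show ?thesis
    using True by (simp add: pf_coeff_def residue_ratio_def)
next
  case False
  then have "pf_coeff H 0 j d = 0"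
    by (intro pf_coeff_eq_0 assms) auto
  with False show ?thesis by simp
qed

text \<open>Shows that \<open>vec_B\<close> lists the coefficients obtained by expanding every
  partial fraction with coefficient \<open>pi_B\<close> in the functions
  \<open>ratfun\<close>.\<close>

lemma coeff_vec_B:
  assumes j: "j \<in> {1..q}"
  shows "coeff (vec_B p q r a b \<kappa> n m j) d =
    (\<Sum>H\<in>{1..q}. \<Sum>K<m H. pi_B p q b \<kappa> n m H K * pf_coeff H K j d)"
proof (cases "m j = 0")
  case True
  \<comment> \<open>\<open>vec_B\<close> is 0 by convention here. On the right,
    \<open>m j = 0\<close> forces \<open>m H \<le> 1\<close>, hence \<open>K = 0\<close> and
    \<open>H \<noteq> j\<close>, where the expansion coefficient vanishes.\<close>
  have "pf_coeff H K j d = 0" if "H \<in> {1..q}" "K < m H" for H K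
  proof (rule pf_coeff_eq_0[OF that(1)])
    have "H \<noteq> j" using that True by auto
    with near[OF that(1) j] that True show "K + of_bool (j = H) \<le> d" by simp
  qed
  then have "(\<Sum>H\<in>{1..q}. \<Sum>K<m H. pi_B p q b \<kappa> n m H K * pf_coeff H K j d) = 0"
    by (intro sum.neutral) auto
  with True show ?thesis by (simp add: vec_B_def)
next
  case False
  let ?\<pi> = "pi_B p q b \<kappa> n m"
  have split: "(\<Sum>K<m H. ?\<pi> H K * pf_coeff H K j d) =
      of_bool (H = j) * of_bool (d = 0) * ?\<pi> j 0 + (\<Sum>K\<in>{1..m H - 1}. ?\<pi> H K * pf_coeff H K j d)"
    if H: "H \<in> {1..q}" for H
  proof (cases "m H")
    case 0
    with False have "H \<noteq> j" by auto
    with 0 show ?thesis by simp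
  next
    case (Suc M)
    have "(\<Sum>K<m H. ?\<pi> H K * pf_coeff H K j d) =
        ?\<pi> H 0 * pf_coeff H 0 j d + (\<Sum>K\<in>{1..m H - 1}. ?\<pi> H K * pf_coeff H K j d)"
      unfolding Suc by (subst sum.lessThan_Suc_shift) (simp add: sum.shift_bounds_Suc_ivl sum.atLeast1_atMost_eq)
    also have "pf_coeff H 0 j d = of_bool (H = j) * of_bool (d = 0)"
      using pf_coeff_0[OF H, of j d] Suc by auto
    finally show ?thesis by auto
  qed
  define C where "C = (\<lambda>H K. (\<Prod>h\<in>{1..q} - {j}. pochhammer (b h - (b H + of_nat K)) 1) /
                     (\<Prod>\<rho>\<in>{1..r}. pochhammer (a \<rho> - (b H + of_nat K)) 1))"
  define E where "E = (\<lambda>H K d. (\<Prod>h\<in>{1..q}. pochhammer (b h - (b H + of_nat K) + 1 - of_bool (h = j)) d) /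
                   (\<Prod>\<rho>\<in>{1..r}. pochhammer (a \<rho> - (b H + of_nat K) + 1) d))"
  \<comment> \<open>The upper limit of \<open>d\<close> in \<open>vec_B\<close> is exactly the point
    after which \<open>pf_coeff\<close> vanishes, so cutting the sum there loses nothing.\<close>
  have pf: "residue_ratio j * (?\<pi> H K * C H K * (if d \<le> K - 1 + of_bool (j = H) then E H K d else 0)) =
      ?\<pi> H K * pf_coeff H K j d" if "H \<in> {1..q}" "K \<in> {1..m H - 1}" for H K
  proof (cases "d \<le> K - 1 + of_bool (j = H)")
    case True
    then show ?thesis by (simp add: pf_coeff_def C_def E_def mult_ac)
  next
    case False
    then have "pf_coeff H K j d = 0"
      using that by (intro pf_coeff_eq_0) auto
    with False show ?thesis by simp
  qed
  have "vec_B p q r a b \<kappa> n m j = [:?\<pi> j 0:] + smult (residue_ratio j)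
      (\<Sum>H\<in>{1..q}. \<Sum>K\<in>{1..m H - 1}. smult (?\<pi> H K * C H K)
         (\<Sum>d\<in>{0..K - 1 + of_bool (j = H)}. monom (E H K d) d))"
    using False j by (simp add: vec_B_def residue_ratio_def C_def E_def)
  then have "coeff (vec_B p q r a b \<kappa> n m j) d = of_bool (d = 0) * ?\<pi> j 0 +
      residue_ratio j * (\<Sum>H\<in>{1..q}. \<Sum>K\<in>{1..m H - 1}. ?\<pi> H K * C H K *
         (if d \<le> K - 1 + of_bool (j = H) then E H K d else 0))"
    by (simp add: coeff_sum coeff_pCons split: nat.split)
  also have "\<dots> = of_bool (d = 0) * ?\<pi> j 0 + (\<Sum>H\<in>{1..q}. \<Sum>K\<in>{1..m H - 1}. ?\<pi> H K * pf_coeff H K j d)"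
    unfolding sum_distrib_left by (intro arg_cong2[of _ _ _ _ "(+)"] sum.cong refl pf)
  also have "of_bool (d = 0) * ?\<pi> j 0 = (\<Sum>H\<in>{1..q}. of_bool (H = j) * of_bool (d = 0) * ?\<pi> j 0)"
    using j by (simp add: of_bool_def if_distrib[of "\<lambda>x. x * _"] sum.delta cong: if_cong)
  finally show ?thesis by (simp add: split sum.distrib)
qed

lemma coeff_vec_B_eq_0:
  assumes "j \<in> {1..q}" "m j \<le> d"
  shows "coeff (vec_B p q r a b \<kappa> n m j) d = 0"
proof -
  have "pf_coeff H K j d = 0" if "H \<in> {1..q}" "K < m H" for H K
    using that near[OF that(1) assms(1)] assms by (intro pf_coeff_eq_0) auto
  then show ?thesis unfolding coeff_vec_B[OF assms(1)] by (intro sum.neutral) auto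
qed

end

section \<open>Nodes, poles and the explicit vectors\<close>

lemma one_dimensionalI:
  assumes "v \<in> S" "v \<noteq> 0" "\<And>c. vec_scale c v \<in> S" "\<forall>P\<in>S. \<exists>c. P = vec_scale c v"
  shows "one_dimensional S"
proof -
  interpret vector_space vec_scale by (rule vector_space_vec_scale)
  have S: "S = span {v}"
    using assms(3,4) unfolding span_singleton by blast
  have "independent {v}"
    using assms(2) by (simp add: dependent_single)
  then have "dim (span {v}) = 1"
    by (subst dim_span_eq_card_independent) simp_all
  then show ?thesis
    unfolding one_dimensional_def S using subspace_span by simp
qed

section \<open>Distinct lattice points and products of their differences\<close>

lemma inj_on_lattice_nodes:
  fixes c :: "nat \<Rightarrow> complex"
  assumes "\<And>i h. i \<in> I \<Longrightarrow> h \<in> I \<Longrightarrow> i \<noteq> h \<Longrightarrow> c i - c h \<notin> \<int>"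
  shows "inj_on (\<lambda>(i, k). c i + of_nat k) (Sigma I A)"
proof (rule inj_onI)
  fix u v assume uv: "u \<in> Sigma I A" "v \<in> Sigma I A" "(case u of (i, k) \<Rightarrow> c i + of_nat k) = (case v of (i, k) \<Rightarrow> c i + of_nat k)"
  obtain i k h l where [simp]: "u = (i, k)" "v = (h, l)" by (cases u, cases v) auto
  have "c i - c h = of_int (int l - int k)" using uv(3) by (simp add: algebra_simps)
  then have "i = h" using assms[of i h] uv(1,2) by (metis Ints_of_int SigmaD1 \<open>u = (i, k)\<close> \<open>v = (h, l)\<close>)
  with uv(3) show "u = v" by simp
qed

lemma prod_Sigma_remove:
  fixes f :: "'i \<times> 'k \<Rightarrow> 'b :: comm_monoid_mult"
  assumes "finite I" "\<And>i. i \<in> I \<Longrightarrow> finite (A i)" "i \<in> I"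
  shows "prod f (Sigma I A - {(i, k)}) =
    (\<Prod>u\<in>A i - {k}. f (i, u)) * (\<Prod>h\<in>I - {i}. \<Prod>u\<in>A h. f (h, u))"
proof -
  have "Sigma I A - {(i, k)} = Sigma I (\<lambda>h. A h - (if h = i then {k} else {}))"
    by (auto split: if_splits)
  then have "prod f (Sigma I A - {(i, k)}) = (\<Prod>h\<in>I. \<Prod>u\<in>A h - (if h = i then {k} else {}). f (h, u))"
    using assms by (simp add: prod.Sigma)
  also have "\<dots> = (\<Prod>u\<in>A i - {k}. f (i, u)) * (\<Prod>h\<in>I - {i}. \<Prod>u\<in>A h. f (h, u))"
    using assms by (subst prod.remove[of I i]) (auto intro!: prod.cong)
  finally show ?thesis .
qed

text \<open>The factors with \<open>u < K\<close> form \<open>pochhammer (- K) K\<close>, which is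
  \<open>(- 1) ^ K * fact K\<close>; those with \<open>u > K\<close> give the other
  factorial.\<close>

lemma prod_diff_nat_except:
  assumes "K < M"
  shows "(\<Prod>u\<in>{..<M} - {K}. of_nat u - of_nat K) =
    ((- 1) ^ K * fact K * fact (M - K - 1) :: 'a :: {idom, ring_char_0})"
proof -
  have set_eq: "{..<M} - {K} = {..<K} \<union> {Suc K..<M}" using assms by auto
  have "(\<Prod>u\<in>{..<M} - {K}. of_nat u - of_nat K) =
      (\<Prod>u<K. of_nat u - of_nat K) * (\<Prod>u\<in>{Suc K..<M}. of_nat u - of_nat K :: 'a)"
    unfolding set_eq by (rule prod.union_disjoint) auto
  also have "(\<Prod>u<K. of_nat u - of_nat K :: 'a) = pochhammer (- of_nat K) K"
    by (simp add: pochhammer_prod atLeast0LessThan)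
  also have "(\<Prod>u\<in>{Suc K..<M}. of_nat u - of_nat K :: 'a) = (\<Prod>u\<in>{0..<M - K - 1}. 1 + of_nat u)"
    by (rule prod.reindex_bij_witness[of _ "\<lambda>u. u + Suc K" "\<lambda>u. u - Suc K"]) (use assms in \<open>auto simp: of_nat_diff\<close>)
  also have "\<dots> = fact (M - K - 1)"
    by (simp add: pochhammer_fact pochhammer_prod)
  finally show ?thesis by (simp add: pochhammer_same)
qed

lemma prod_diff_nat_except':
  assumes "k < N"
  shows "(\<Prod>u\<in>{..<N} - {k}. of_nat k - of_nat u) =
    ((- 1) ^ (N - 1 + k) * fact k * fact (N - k - 1) :: 'a :: {idom, ring_char_0})"
proof -
  have "(\<Prod>u\<in>{..<N} - {k}. of_nat k - of_nat u :: 'a) = (\<Prod>u\<in>{..<N} - {k}. (- 1) * (of_nat u - of_nat k))"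
    by simp
  also have "\<dots> = (- 1) ^ (N - 1) * (\<Prod>u\<in>{..<N} - {k}. of_nat u - of_nat k)"
    unfolding prod.distrib using assms by simp
  finally show ?thesis by (simp only: prod_diff_nat_except[OF assms] power_add mult.assoc)
qed

lemma prod_diff_of_nat: "(\<Prod>u<N. y - of_nat u) = pochhammer (y - of_nat N + 1 :: 'a :: comm_ring_1) N"
  by (subst pochhammer_prod, rule prod.reindex_bij_witness[of _ "\<lambda>u. N - 1 - u" "\<lambda>u. N - 1 - u"])
     (auto simp: of_nat_diff)

text \<open>Converts the terminating factor \<open>pochhammer (1 - n i) k\<close> of
  \<open>vec_A\<close> into the factorials of a product of node differences.\<close>

lemma pochhammer_minus_of_nat_times_fact:
  assumes "k \<le> N"
  shows "pochhammer (- of_nat N) k * fact (N - k) = ((- 1) ^ k * fact N :: 'a :: {idom, ring_char_0})"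
  using assms
proof (induction k)
  case (Suc k)
  have "fact (N - k) = (of_nat N - of_nat k) * (fact (N - Suc k) :: 'a)"
    using Suc.prems by (subst fact_reduce) (auto simp: of_nat_diff)
  with Suc show ?case by (simp add: pochhammer_Suc algebra_simps)
qed simp

context hypergeometric_system
begin

definition nodes :: "(nat \<times> nat) set" where "nodes = Sigma {1..p} (\<lambda>i. {..<n i})"
definition node :: "nat \<times> nat \<Rightarrow> complex" where "node = (\<lambda>(i, k). \<kappa> i + of_nat k)"
definition poles :: "(nat \<times> nat) set" where "poles = Sigma {1..q} (\<lambda>h. {..<m h})"
definition pole :: "nat \<times> nat \<Rightarrow> complex" where "pole = (\<lambda>(h, u). - (b h + 1 + of_nat u))"

lemma finite_nodes: "finite nodes" and finite_poles: "finite poles"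
  by (auto simp: nodes_def poles_def)

lemma card_nodes: "card nodes = sum n {1..p}" and card_poles: "card poles = sum m {1..q}"
  by (auto simp: nodes_def poles_def card_SigmaI)

text \<open>Stated for any \<open>A\<close>, since it is also applied to a set with one more point
  for each \<open>i\<close>.\<close>

lemma inj_on_node: "inj_on node (Sigma {1..p} A)"
  unfolding node_def by (rule inj_on_lattice_nodes) (rule \<kappa>_diff)

lemma inj_on_pole: "inj_on pole poles"
proof -
  have "inj_on (\<lambda>(h, u). b h + of_nat u) poles"
    unfolding poles_def by (rule inj_on_lattice_nodes) (rule b_diff)
  moreover have "pole = (\<lambda>y. - y - 1) \<circ> (\<lambda>(h, u). b h + of_nat u)"
    by (auto simp: pole_def)
  ultimately show ?thesis
    by (simp only:) (intro comp_inj_on, auto simp: inj_on_def)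
qed

lemma poly_denom_poles: "poly denom x = (\<Prod>v\<in>poles. x - pole v)"
proof -
  have "(\<Prod>v\<in>poles. x - pole v) = (\<Prod>(h, u)\<in>poles. x + b h + 1 + of_nat u)"
    by (rule prod.cong) (auto simp: pole_def)
  then show ?thesis
    unfolding poly_denom poles_def
    by (subst (asm) prod.Sigma[symmetric]) (auto simp: pochhammer_prod atLeast0LessThan)
qed

lemma regular_point_pole: "regular_point x \<Longrightarrow> v \<in> poles \<Longrightarrow> x - pole v \<noteq> 0"
  using regular_pointD[of x "fst v" "snd v"] by (auto simp: poles_def pole_def add_ac split_beta)

lemma regular_point_node': "v \<in> nodes \<Longrightarrow> regular_point (node v)"
  using regular_point_node by (auto simp: nodes_def node_def)

text \<open>Lagrange interpolation of \<open>f\<close> at the poles, divided by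
  \<open>denom\<close>, whose zeros are simple.\<close>

lemma partial_fraction_decomposition:
  assumes "degree f < sum m {1..q}" "regular_point x"
  shows "poly f x / poly denom x =
    (\<Sum>v\<in>poles. poly f (pole v) / (\<Prod>w\<in>poles - {v}. pole v - pole w) / (x - pole v))"
proof -
  have "poly f x / poly denom x = (\<Sum>v\<in>poles. poly f (pole v) / (\<Prod>w\<in>poles - {v}. pole v - pole w) *
      (\<Prod>w\<in>poles - {v}. x - pole w) / poly denom x)"
    using assms(1)
    by (subst poly_lagrange_eval[OF finite_poles inj_on_pole]) (simp_all add: card_poles sum_divide_distrib)
  also have "\<dots> = (\<Sum>v\<in>poles. poly f (pole v) / (\<Prod>w\<in>poles - {v}. pole v - pole w) / (x - pole v))"
  proof (rule sum.cong[OF refl])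
    fix v assume v: "v \<in> poles"
    have "poly denom x = (x - pole v) * (\<Prod>w\<in>poles - {v}. x - pole w)"
      unfolding poly_denom_poles using v finite_poles by (rule prod.remove[rotated])
    moreover have "(\<Prod>w\<in>poles - {v}. x - pole w) \<noteq> 0"
      using regular_point_pole[OF assms(2)] finite_poles by auto
    ultimately show "poly f (pole v) / (\<Prod>w\<in>poles - {v}. pole v - pole w) *
        (\<Prod>w\<in>poles - {v}. x - pole w) / poly denom x =
        poly f (pole v) / (\<Prod>w\<in>poles - {v}. pole v - pole w) / (x - pole v)"
      by simp
  qed
  finally show ?thesis .
qed

lemma sum_nodes: "(\<Sum>i\<in>{1..p}. \<Sum>k<n i. f i k) = (\<Sum>(i, k)\<in>nodes. f i k)"
  unfolding nodes_def by (rule sum.Sigma) auto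

lemma sum_poles: "(\<Sum>i\<in>{1..q}. \<Sum>k<m i. f i k) = (\<Sum>(i, k)\<in>poles. f i k)"
  unfolding poles_def by (rule sum.Sigma) auto

text \<open>This is the derivative of \<open>denom\<close> at one of its zeros, in the form of the
  denominator of \<open>pi_B\<close>.\<close>

lemma prod_pole_diff:
  assumes "H \<in> {1..q}" "K < m H"
  shows "(\<Prod>w\<in>poles - {(H, K)}. pole (H, K) - pole w) =
    (- 1) ^ K * fact K * fact (m H - K - 1) * (\<Prod>I\<in>{1..q} - {H}. pochhammer (b I - b H - of_nat K) (m I))"
proof -
  have "(\<Prod>w\<in>poles - {(H, K)}. pole (H, K) - pole w) =
      (\<Prod>u\<in>{..<m H} - {K}. of_nat u - of_nat K) *
      (\<Prod>I\<in>{1..q} - {H}. \<Prod>u<m I. b I - b H - of_nat K + of_nat u)"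
    unfolding poles_def using assms by (subst prod_Sigma_remove) (auto simp: pole_def algebra_simps intro!: prod.cong)
  then show ?thesis
    using assms(2) by (simp add: prod_diff_nat_except pochhammer_prod atLeast0LessThan)
qed

lemma prod_node_diff:
  assumes "i \<in> {1..p}" "k < n i"
  shows "(\<Prod>w\<in>nodes - {(i, k)}. node (i, k) - node w) =
    (- 1) ^ (n i - 1 + k) * fact k * fact (n i - k - 1) *
    (\<Prod>l\<in>{1..p} - {i}. pochhammer (\<kappa> i - \<kappa> l - of_nat (n l) + 1 + of_nat k) (n l))"
proof -
  have "(\<Prod>w\<in>nodes - {(i, k)}. node (i, k) - node w) =
      (\<Prod>u\<in>{..<n i} - {k}. of_nat k - of_nat u) *
      (\<Prod>l\<in>{1..p} - {i}. \<Prod>u<n l. \<kappa> i - \<kappa> l + of_nat k - of_nat u)"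
    unfolding nodes_def using assms by (subst prod_Sigma_remove) (auto simp: node_def algebra_simps intro!: prod.cong)
  moreover have "(\<Prod>u<n l. \<kappa> i - \<kappa> l + of_nat k - of_nat u) =
      pochhammer (\<kappa> i - \<kappa> l - of_nat (n l) + 1 + of_nat k) (n l)" for l
    unfolding prod_diff_of_nat by (simp add: algebra_simps)
  ultimately show ?thesis
    by (simp only: prod_diff_nat_except'[OF assms(2)])
qed

section \<open>The explicit vectors in terms of nodes and poles\<close>

definition node_poly :: "complex poly" where "node_poly = (\<Prod>v\<in>nodes. [:- node v, 1:])"

lemma poly_node_poly: "poly node_poly x = (\<Prod>v\<in>nodes. x - node v)"
  by (simp add: node_poly_def poly_prod)

lemma degree_node_poly: "degree node_poly = sum n {1..p}"
  unfolding node_poly_def by (subst degree_prod_eq_sum_degree) (auto simp: card_nodes)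

lemma poly_node_poly_pole:
  "poly node_poly (pole (H, K)) =
     (- 1) ^ sum n {1..p} * (\<Prod>i\<in>{1..p}. pochhammer (\<kappa> i + b H + of_nat K + 1) (n i))"
proof -
  have "poly node_poly (pole (H, K)) = (\<Prod>(i, k)\<in>nodes. (- 1) * (\<kappa> i + b H + of_nat K + 1 + of_nat k))"
    unfolding poly_node_poly by (rule prod.cong) (auto simp: node_def pole_def algebra_simps)
  also have "\<dots> = (- 1) ^ card nodes * (\<Prod>(i, k)\<in>nodes. \<kappa> i + b H + of_nat K + 1 + of_nat k)"
    unfolding split_beta prod.distrib by simp
  also have "(\<Prod>(i, k)\<in>nodes. \<kappa> i + b H + of_nat K + 1 + of_nat k) =
      (\<Prod>i\<in>{1..p}. \<Prod>k<n i. \<kappa> i + b H + of_nat K + 1 + of_nat k)"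
    unfolding nodes_def by (subst prod.Sigma) auto
  finally show ?thesis
    by (simp add: card_nodes pochhammer_prod atLeast0LessThan)
qed

text \<open>Up to the factor \<open>- ((- 1) ^ |n|)\<close>, \<open>pi_B H K\<close> is the residue
  of \<open>node_poly / denom\<close> at \<open>pole (H, K)\<close>. As \<open>|n| < |m|\<close>,
  that quotient is the sum of its partial fractions.\<close>

lemma sum_vec_B:
  assumes "sum m {1..q} = sum n {1..p} + 1" "regular_point x"
  shows "(\<Sum>j\<in>{1..q}. \<Sum>d<m j. coeff (vec_B p q r a b \<kappa> n m j) d * ratfun j d x) =
    - ((- 1) ^ sum n {1..p}) * poly node_poly x / poly denom x"
proof -
  let ?\<pi> = "pi_B p q b \<kappa> n m"
  let ?s = "(- 1) ^ sum n {1..p} :: complex"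
  have "(\<Sum>j\<in>{1..q}. \<Sum>d<m j. coeff (vec_B p q r a b \<kappa> n m j) d * ratfun j d x) =
      (\<Sum>(j, d)\<in>poles. \<Sum>(H, K)\<in>poles. ?\<pi> H K * pf_coeff H K j d * ratfun j d x)"
    unfolding sum_poles
  proof (rule sum.cong[OF refl])
    fix v assume "v \<in> poles"
    then have "fst v \<in> {1..q}" by (auto simp: poles_def)
    from coeff_vec_B[OF this, unfolded sum_poles]
    show "(case v of (j, d) \<Rightarrow> coeff (vec_B p q r a b \<kappa> n m j) d * ratfun j d x) =
        (case v of (j, d) \<Rightarrow> \<Sum>(H, K)\<in>poles. ?\<pi> H K * pf_coeff H K j d * ratfun j d x)"
      by (simp add: split_beta sum_distrib_right)
  qed
  also have "\<dots> = (\<Sum>(H, K)\<in>poles. ?\<pi> H K * (\<Sum>(j, d)\<in>poles. pf_coeff H K j d * ratfun j d x))"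
    unfolding split_beta sum_distrib_left mult.assoc by (rule sum.swap)
  also have "\<dots> = (\<Sum>v\<in>poles. - ?s * (poly node_poly (pole v) / (\<Prod>w\<in>poles - {v}. pole v - pole w) / (x - pole v)))"
  proof (rule sum.cong[OF refl])
    fix v assume "v \<in> poles"
    then obtain H K where v: "v = (H, K)" "H \<in> {1..q}" "K < m H" by (auto simp: poles_def)
    \<comment> \<open>The sign from evaluating \<open>node_poly\<close> at a pole cancels against
      the sign in front.\<close>
    have "?s * ?s = 1" by (simp flip: power_mult_distrib)
    then have "- ?s * (?s * X / Y / Z) = - (X / Y) * (1 / Z)" for X Y Z :: complex
      unfolding times_divide_eq_right[symmetric] times_divide_eq_left[symmetric] minus_mult_left[symmetric]
        mult.assoc[symmetric] by simp
    moreover have "(\<Sum>(j, d)\<in>poles. pf_coeff H K j d * ratfun j d x) = 1 / (x - pole v)"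
      using partial_fraction_expansion[OF v(2,3) assms(2)] unfolding sum_poles by (simp add: v(1) pole_def add_ac)
    ultimately show "(case v of (H, K) \<Rightarrow> ?\<pi> H K * (\<Sum>(j, d)\<in>poles. pf_coeff H K j d * ratfun j d x)) =
        - ?s * (poly node_poly (pole v) / (\<Prod>w\<in>poles - {v}. pole v - pole w) / (x - pole v))"
      unfolding v(1) by (simp only: case_prod_conv poly_node_poly_pole prod_pole_diff[OF v(2,3)] pi_B_def)
  qed
  also have "\<dots> = - ?s * (poly node_poly x / poly denom x)"
    unfolding sum_distrib_left[symmetric]
    by (subst partial_fraction_decomposition[OF _ assms(2)]) (use assms(1) in \<open>simp_all add: degree_node_poly\<close>)
  finally show ?thesis by simp
qed

text \<open>Relative to the Gamma quotient, the coefficients of \<open>vec_A\<close> are the divided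
  difference weights of the nodes times the values of \<open>denom\<close>.\<close>

lemma coeff_vec_A_times_gamma_quot:
  assumes "i \<in> {1..p}" "k < n i"
  shows "coeff (vec_A p q r a b \<kappa> n m i) k * gamma_quot (\<kappa> i + of_nat k) =
    (- 1) ^ sum n {1..p} * poly denom (node (i, k)) / (\<Prod>w\<in>nodes - {(i, k)}. node (i, k) - node w)"
proof -
  define G1 where "G1 = (\<Prod>j\<in>{1..q}. Gamma (\<kappa> i + b j + 1))"
  define G2 where "G2 = (\<Prod>\<rho>\<in>{1..r}. Gamma (\<kappa> i + a \<rho> + 1))"
  define A where "A = (\<Prod>\<rho>\<in>{1..r}. pochhammer (\<kappa> i + a \<rho> + 1) k)"
  define B where "B = (\<Prod>j\<in>{1..q}. pochhammer (\<kappa> i + b j + 1) k)"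
  define M0 where "M0 = (\<Prod>j\<in>{1..q}. pochhammer (\<kappa> i + b j + 1) (m j))"
  define M where "M = (\<Prod>j\<in>{1..q}. pochhammer (\<kappa> i + b j + of_nat (m j) + 1) k)"
  define L0 where "L0 = (\<Prod>l\<in>{1..p} - {i}. pochhammer (\<kappa> i - \<kappa> l - of_nat (n l) + 1) (n l))"
  define L where "L = (\<Prod>l\<in>{1..p} - {i}. pochhammer (\<kappa> i - \<kappa> l - of_nat (n l) + 1) k)"
  define L' where "L' = (\<Prod>l\<in>{1..p} - {i}. pochhammer (\<kappa> i - \<kappa> l + 1) k)"
  define X where "X = (\<Prod>l\<in>{1..p} - {i}. pochhammer (\<kappa> i - \<kappa> l - of_nat (n l) + 1 + of_nat k) (n l))"
  define F where "F = (pochhammer (1 - of_nat (n i)) k :: complex)"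
  define s where "s = ((- 1) ^ sum n {1..p} :: complex)"
  have \<kappa>_nz: "\<kappa> i - \<kappa> l + of_int t \<noteq> 0" if "l \<in> {1..p} - {i}" for l t
    using \<kappa>_diff[of i l] that assms(1) by (metis Diff_iff Ints_minus Ints_of_int add_eq_0_iff add.commute insert_iff)
  have "pochhammer (\<kappa> i - \<kappa> l + of_int t) N \<noteq> 0" if "l \<in> {1..p} - {i}" for l t N
    using \<kappa>_nz[OF that, of "t + int u" for u] by (auto simp: pochhammer_prod add_ac)
  from this[of _ "1 - int (n l) + int k" for l] this[of _ "1 - int (n l)" for l] this[of _ 1]
  have nz1: "L0 \<noteq> 0" "L' \<noteq> 0" "X \<noteq> 0"
    by (auto simp: L0_def L'_def X_def algebra_simps)
  have nz2: "G1 \<noteq> 0" "G2 \<noteq> 0" "A \<noteq> 0" "B \<noteq> 0"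
    using \<kappa>a[OF assms(1)] \<kappa>b[OF assms(1)]
    by (auto simp: G1_def G2_def A_def B_def Gamma_eq_zero_iff dest: pochhammer_eq_0_imp_nonpos_Int)
  have gq: "gamma_quot (\<kappa> i + of_nat k) = G2 * A / (G1 * B)"
  proof -
    have "Gamma (\<kappa> i + of_nat k + c + 1) = Gamma (\<kappa> i + c + 1) * pochhammer (\<kappa> i + c + 1) k"
      if "\<kappa> i + c + 1 \<notin> \<int>\<^sub>\<le>\<^sub>0" for c
      using Gamma_add_of_nat[OF that, of k] by (simp add: add_ac)
    then show ?thesis
      using \<kappa>a[OF assms(1)] \<kappa>b[OF assms(1)]
      by (simp add: gamma_quot_def G1_def G2_def A_def B_def prod.distrib)
  qed
  \<comment> \<open>Both sides split the Pochhammer symbols of length \<open>m j + k\<close>, once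
    after \<open>m j\<close> and once after \<open>k\<close> factors.\<close>
  have D: "M0 * M = B * poly denom (node (i, k))"
    unfolding M0_def M_def B_def poly_denom prod.distrib[symmetric]
  proof (rule prod.cong[OF refl])
    fix j
    show "pochhammer (\<kappa> i + b j + 1) (m j) * pochhammer (\<kappa> i + b j + of_nat (m j) + 1) k =
        pochhammer (\<kappa> i + b j + 1) k * pochhammer (node (i, k) + b j + 1) (m j)"
      using pochhammer_product'[of "\<kappa> i + b j + 1" "m j" k] pochhammer_product'[of "\<kappa> i + b j + 1" k "m j"]
      by (simp add: node_def add_ac)
  qed
  \<comment> \<open>The same double splitting, for symbols of length \<open>n l + k\<close> starting
    at \<open>\<kappa> i - \<kappa> l - n l + 1\<close>.\<close>
  have LX: "L0 * L' = L * X"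
    unfolding L0_def L'_def L_def X_def prod.distrib[symmetric]
  proof (rule prod.cong[OF refl])
    fix l
    let ?c = "\<kappa> i - \<kappa> l - of_nat (n l) + 1"
    show "pochhammer ?c (n l) * pochhammer (\<kappa> i - \<kappa> l + 1) k = pochhammer ?c k * pochhammer (?c + of_nat k) (n l)"
      using pochhammer_product'[of ?c "n l" k] pochhammer_product'[of ?c k "n l"]
      by (simp add: add_ac)
  qed
  have fact: "F * fact (n i - k - 1) = (- 1) ^ k * fact (n i - 1)"
    using pochhammer_minus_of_nat_times_fact[of k "n i - 1", where 'a = complex] assms(2)
    by (simp add: F_def of_nat_diff)
  have "coeff (vec_A p q r a b \<kappa> n m i) k =
      s * (G1 / G2) * (M0 / ((- 1) ^ (n i - 1) * fact (n i - 1) * L0)) * (F * M * L / (A * L') / fact k)"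
    using assms by (simp add: vec_A_def C_A_def coeff_sum G1_def G2_def A_def M0_def M_def L0_def L_def L'_def F_def s_def sum.delta)
  then have "coeff (vec_A p q r a b \<kappa> n m i) k * gamma_quot (\<kappa> i + of_nat k) =
      s * (G1 / G2) * (M0 / ((- 1) ^ (n i - 1) * fact (n i - 1) * L0)) * (F * M * L / (A * L') / fact k) *
      (G2 * A / (G1 * B))"
    unfolding gq by simp
  also have "\<dots> = s * (M0 * M / B) * (L / (L0 * L')) * (F / fact (n i - 1)) / ((- 1) ^ (n i - 1) * fact k)"
    using nz1 nz2 by (simp add: field_simps)
  also have "M0 * M / B = poly denom (node (i, k))"
    using D nz2 by simp
  also have "L / (L0 * L') = 1 / X"
  proof -
    have "L \<noteq> 0" using LX nz1 by auto
    then show ?thesis unfolding LX by simp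
  qed
  also have "F / fact (n i - 1) = 1 / ((- 1) ^ k * fact (n i - k - 1))"
  proof -
    have "(- 1 :: complex) ^ k * (- 1) ^ k = 1" by (simp flip: power_mult_distrib)
    then have "F * ((- 1) ^ k * fact (n i - k - 1)) = fact (n i - 1)"
      using fact by (metis mult.assoc mult.left_commute mult.left_neutral)
    then show ?thesis by (simp add: field_simps)
  qed
  also have "s * poly denom (node (i, k)) * (1 / X) * (1 / ((- 1) ^ k * fact (n i - k - 1))) / ((- 1) ^ (n i - 1) * fact k) =
      s * poly denom (node (i, k)) / ((- 1) ^ (n i - 1 + k) * fact k * fact (n i - k - 1) * X)"
    unfolding power_add by (simp add: mult_ac)
  finally show ?thesis
    unfolding prod_node_diff[OF assms] s_def X_def .
qed

lemma coeff_vec_A_eq_0: "i \<in> {1..p} \<Longrightarrow> n i \<le> k \<Longrightarrow> coeff (vec_A p q r a b \<kappa> n m i) k = 0"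
  by (auto simp: vec_A_def coeff_sum intro!: sum.neutral)

section \<open>Solution spaces\<close>

lemma inj_on_nodes: "inj_on node nodes"
  using inj_on_node by (simp add: nodes_def)

lemma node_diff_neq_0: "v \<in> nodes \<Longrightarrow> w \<in> nodes \<Longrightarrow> w \<noteq> v \<Longrightarrow> node v - node w \<noteq> 0"
  using inj_onD[OF inj_on_nodes] by fastforce

lemma solutions_A_node_iff:
  "P \<in> solutions_A p q r a b \<kappa> n m \<longleftrightarrow>
     (\<forall>i\<in>{1..p}. \<forall>k\<ge>n i. coeff (P i) k = 0) \<and> (\<forall>i. i \<notin> {1..p} \<longrightarrow> P i = 0) \<and>
     (\<forall>j\<in>{1..q}. \<forall>l<m j. (\<Sum>v\<in>nodes.
        coeff (P (fst v)) (snd v) * gamma_quot (node v) * ratfun j l (node v)) = 0)"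
  unfolding solutions_A_iff sum_nodes by (simp only: case_prod_unfold node_def)

lemma solutions_B_node_iff:
  "Q \<in> solutions_B p q r a b \<kappa> n m \<longleftrightarrow>
     (\<forall>j\<in>{1..q}. \<forall>k\<ge>m j. coeff (Q j) k = 0) \<and> (\<forall>j. j \<notin> {1..q} \<longrightarrow> Q j = 0) \<and>
     (\<forall>v\<in>nodes. (\<Sum>j\<in>{1..q}. \<Sum>k<m j. coeff (Q j) k * ratfun j k (node v)) = 0)"
  unfolding solutions_B_iff by (auto simp: nodes_def node_def)

lemma vec_scale_in_solutions_A:
  "P \<in> solutions_A p q r a b \<kappa> n m \<Longrightarrow> vec_scale c P \<in> solutions_A p q r a b \<kappa> n m"
  unfolding solutions_A_node_iff
  by (simp add: vec_scale_def mult.assoc flip: sum_distrib_left)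

lemma vec_scale_in_solutions_B:
  "Q \<in> solutions_B p q r a b \<kappa> n m \<Longrightarrow> vec_scale c Q \<in> solutions_B p q r a b \<kappa> n m"
  unfolding solutions_B_node_iff
  by (simp add: vec_scale_def mult.assoc flip: sum_distrib_left)

section \<open>Problem (A): existence and uniqueness\<close>

lemma solutions_A_diff:
  assumes "P \<in> solutions_A p q r a b \<kappa> n m" "P' \<in> solutions_A p q r a b \<kappa> n m"
  shows "(\<lambda>i. P i - P' i) \<in> solutions_A p q r a b \<kappa> n m"
  using assms unfolding solutions_A_node_iff
  by (simp add: left_diff_distrib sum_subtractf)

text \<open>The values of \<open>denom\<close> in the coefficients clear the denominator of
  \<open>ratfun j l\<close>. What remains is a divided difference over \<open>|n|\<close> nodes of
  \<open>numer j l\<close>, of degree below \<open>|m| = |n| - 1\<close>.\<close>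

lemma vec_A_solution:
  assumes "sum n {1..p} = sum m {1..q} + 1"
  shows "vec_A p q r a b \<kappa> n m \<in> solutions_A p q r a b \<kappa> n m"
  unfolding solutions_A_node_iff
proof (intro conjI ballI allI impI)
  fix j l assume j: "j \<in> {1..q}" and l: "l < m j"
  have "(\<Sum>v\<in>nodes. coeff (vec_A p q r a b \<kappa> n m (fst v)) (snd v) * gamma_quot (node v) * ratfun j l (node v)) =
      (\<Sum>v\<in>nodes. (- 1) ^ sum n {1..p} * (poly (numer j l) (node v) / (\<Prod>w\<in>nodes - {v}. node v - node w)))"
  proof (rule sum.cong[OF refl])
    fix v assume v: "v \<in> nodes"
    then obtain i k where ik: "v = (i, k)" "i \<in> {1..p}" "k < n i" by (auto simp: nodes_def)
    have "coeff (vec_A p q r a b \<kappa> n m i) k * gamma_quot (node v) =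
        (- 1) ^ sum n {1..p} * poly denom (node v) / (\<Prod>w\<in>nodes - {v}. node v - node w)"
      using coeff_vec_A_times_gamma_quot[OF ik(2,3)] by (simp add: ik(1) node_def)
    then show "coeff (vec_A p q r a b \<kappa> n m (fst v)) (snd v) * gamma_quot (node v) * ratfun j l (node v) =
        (- 1) ^ sum n {1..p} * (poly (numer j l) (node v) / (\<Prod>w\<in>nodes - {v}. node v - node w))"
      using poly_numer[OF j l regular_point_denom[OF regular_point_node'[OF v]]] by (simp add: ik(1))
  qed
  also have "\<dots> = 0"
    unfolding sum_distrib_left[symmetric]
    using degree_numer[OF j l] assms
    by (subst divided_difference_eq_0[OF finite_nodes inj_on_nodes]) (auto simp: card_nodes)
  finally show "(\<Sum>v\<in>nodes. coeff (vec_A p q r a b \<kappa> n m (fst v)) (snd v) * gamma_quot (node v) * ratfun j l (node v)) = 0" .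
next
  show "vec_A p q r a b \<kappa> n m i = 0" if "i \<notin> {1..p}" for i
    using that by (simp add: vec_A_def)
qed (simp add: coeff_vec_A_eq_0)

lemma coeff_vec_A_neq_0:
  assumes "(i, k) \<in> nodes"
  shows "coeff (vec_A p q r a b \<kappa> n m i) k \<noteq> 0"
proof -
  have ik: "i \<in> {1..p}" "k < n i" using assms by (auto simp: nodes_def)
  have "(\<Prod>w\<in>nodes - {(i, k)}. node (i, k) - node w) \<noteq> 0"
    using node_diff_neq_0[OF assms] finite_nodes by (subst prod_zero_iff) blast+
  moreover have "poly denom (node (i, k)) \<noteq> 0"
    by (rule regular_point_denom[OF regular_point_node'[OF assms]])
  ultimately show ?thesis
    using coeff_vec_A_times_gamma_quot[OF ik] by auto
qed

text \<open>The weights \<open>w\<close> annihilate all \<open>ratfun j l\<close>, hence all partial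
  fractions, hence all \<open>f / denom\<close> with \<open>degree f < |m|\<close>. An
  \<open>f\<close> vanishing at every node but \<open>v0\<close> and \<open>v\<close> then isolates
  \<open>w v\<close>, because \<open>w v0 = 0\<close>.\<close>

lemma solution_A_eq_0:
  assumes P: "P \<in> solutions_A p q r a b \<kappa> n m" and N: "sum n {1..p} = sum m {1..q} + 1"
    and v0: "v0 \<in> nodes" "coeff (P (fst v0)) (snd v0) = 0"
  shows "P = (\<lambda>i. 0)"
proof -
  define w where "w = (\<lambda>v. coeff (P (fst v)) (snd v) * gamma_quot (node v))"
  have cauchy: "(\<Sum>v\<in>nodes. w v / (node v - pole u)) = 0" if u_in: "u \<in> poles" for u
  proof -
    obtain H K where u: "u = (H, K)" "H \<in> {1..q}" "K < m H"
      using u_in by (auto simp: poles_def)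
    have "(\<Sum>v\<in>nodes. w v / (node v - pole u)) =
        (\<Sum>v\<in>nodes. \<Sum>(j, d)\<in>poles. pf_coeff H K j d * (w v * ratfun j d (node v)))"
    proof (rule sum.cong[OF refl])
      fix v assume "v \<in> nodes"
      from partial_fraction_expansion[OF u(2,3) regular_point_node'[OF this]]
      have "1 / (node v - pole u) = (\<Sum>(j, d)\<in>poles. pf_coeff H K j d * ratfun j d (node v))"
        unfolding sum_poles by (simp add: u(1) pole_def add_ac)
      then have "w v * (1 / (node v - pole u)) = (\<Sum>(j, d)\<in>poles. w v * (pf_coeff H K j d * ratfun j d (node v)))"
        by (simp add: sum_distrib_left split_beta)
      then show "w v / (node v - pole u) = (\<Sum>(j, d)\<in>poles. pf_coeff H K j d * (w v * ratfun j d (node v)))"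
        by (simp add: mult_ac)
    qed
    also have "\<dots> = (\<Sum>(j, d)\<in>poles. pf_coeff H K j d * (\<Sum>v\<in>nodes. w v * ratfun j d (node v)))"
      unfolding split_beta sum_distrib_left by (rule sum.swap)
    also have "\<dots> = 0"
      using P unfolding solutions_A_node_iff w_def by (intro sum.neutral) (auto simp: poles_def)
    finally show ?thesis .
  qed
  have w0: "w v = 0" if v: "v \<in> nodes" for v
  proof (cases "v = v0")
    case True
    then show ?thesis using v0 by (simp add: w_def)
  next
    case False
    define f where "f = (\<Prod>u\<in>nodes - {v0, v}. [:- node u, 1:])"
    have f: "poly f x = (\<Prod>u\<in>nodes - {v0, v}. x - node u)" for x
      by (simp add: f_def poly_prod)
    have "card (nodes - {v0, v}) = card nodes - 2"
      using v v0 False finite_nodes by (subst card_Diff_subset) auto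
    \<comment> \<open>Two distinct nodes give \<open>|n| \<ge> 2\<close>, so the subtraction does
      not truncate and \<open>degree f = |n| - 2 = |m| - 1\<close>.\<close>
    moreover have "card nodes \<ge> card {v0, v}"
      using v v0 finite_nodes by (intro card_mono) auto
    ultimately have deg: "degree f < sum m {1..q}"
      unfolding f_def using N False by (subst degree_prod_eq_sum_degree) (auto simp: card_nodes)
    \<comment> \<open>The residues of \<open>f / denom\<close>; they turn the values of this
      quotient at the nodes into Cauchy sums that vanish by \<open>cauchy\<close>.\<close>
    define c where "c = (\<lambda>u. poly f (pole u) / (\<Prod>u'\<in>poles - {u}. pole u - pole u'))"
    have "(\<Sum>x\<in>nodes. w x * (poly f (node x) / poly denom (node x))) =
        (\<Sum>x\<in>nodes. \<Sum>u\<in>poles. c u * (w x / (node x - pole u)))"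
    proof (rule sum.cong[OF refl])
      fix x assume "x \<in> nodes"
      from partial_fraction_decomposition[OF deg regular_point_node'[OF this]]
      have "w x * (poly f (node x) / poly denom (node x)) = (\<Sum>u\<in>poles. w x * (c u / (node x - pole u)))"
        by (simp add: c_def sum_distrib_left)
      then show "w x * (poly f (node x) / poly denom (node x)) = (\<Sum>u\<in>poles. c u * (w x / (node x - pole u)))"
        by (simp add: mult_ac)
    qed
    also have "\<dots> = (\<Sum>u\<in>poles. c u * (\<Sum>x\<in>nodes. w x / (node x - pole u)))"
      unfolding sum_distrib_left by (rule sum.swap)
    also have "\<dots> = 0"
      using cauchy by (intro sum.neutral) auto
    finally have "0 = (\<Sum>x\<in>nodes. w x * (poly f (node x) / poly denom (node x)))" by simp
    also have "\<dots> = (\<Sum>x\<in>nodes. if x = v then w v * (poly f (node v) / poly denom (node v)) else 0)"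
    proof (rule sum.cong[OF refl])
      fix x assume x: "x \<in> nodes"
      show "w x * (poly f (node x) / poly denom (node x)) =
          (if x = v then w v * (poly f (node v) / poly denom (node v)) else 0)"
      proof (cases "x = v \<or> x = v0")
        case True
        then show ?thesis using v0 by (auto simp: w_def)
      next
        case False
        then have "poly f (node x) = 0"
          unfolding f using x finite_nodes by (intro prod_zero bexI[of _ x]) auto
        with False show ?thesis by simp
      qed
    qed
    also have "\<dots> = w v * (poly f (node v) / poly denom (node v))"
      using v finite_nodes by simp
    finally have "w v * (poly f (node v) / poly denom (node v)) = 0" by simp
    moreover have "poly denom (node v) \<noteq> 0"
      by (rule regular_point_denom[OF regular_point_node'[OF v]])
    moreover have "poly f (node v) \<noteq> 0"
      unfolding f using node_diff_neq_0[OF v] finite_nodes by (subst prod_zero_iff) blast+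
    ultimately show ?thesis by simp
  qed
  show ?thesis
  proof (rule ext, rule poly_eqI)
    fix i k
    show "coeff (P i) k = coeff 0 k"
    proof (cases "i \<in> {1..p} \<and> k < n i")
      case True
      with w0[of "(i, k)"] gamma_quot_neq_0[of i k] show ?thesis
        by (auto simp: w_def nodes_def node_def)
    next
      case False
      with P show ?thesis unfolding solutions_A_node_iff by (metis coeff_0 not_less)
    qed
  qed
qed

text \<open>At any node the coefficient of \<open>vec_A\<close> is nonzero, so some multiple of
  \<open>vec_A\<close> matches \<open>P\<close> there; the difference is a solution with a zero
  coefficient at that node.\<close>

lemma solutions_A_main:
  assumes N: "sum n {1..p} = sum m {1..q} + 1"
  shows "vec_A p q r a b \<kappa> n m \<noteq> 0"
    and "P \<in> solutions_A p q r a b \<kappa> n m \<Longrightarrow> \<exists>c. P = vec_scale c (vec_A p q r a b \<kappa> n m)"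
proof -
  let ?A = "vec_A p q r a b \<kappa> n m"
  have "card nodes \<noteq> 0" using N by (simp add: card_nodes)
  then have "nodes \<noteq> {}" by auto
  then obtain i k where v: "(i, k) \<in> nodes" by (metis all_not_in_conv surj_pair)
  have nz: "coeff (?A i) k \<noteq> 0" by (rule coeff_vec_A_neq_0[OF v])
  then show "?A \<noteq> 0" by auto
  assume P: "P \<in> solutions_A p q r a b \<kappa> n m"
  define c where "c = coeff (P i) k / coeff (?A i) k"
  have "(\<lambda>i. P i - vec_scale c ?A i) = (\<lambda>i. 0)"
    by (rule solution_A_eq_0[OF solutions_A_diff[OF P vec_scale_in_solutions_A[OF vec_A_solution[OF N]]] N v])
       (use nz in \<open>simp add: c_def vec_scale_def\<close>)
  then have "P = vec_scale c ?A" by (metis eq_iff_diff_eq_0 ext)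
  then show "\<exists>c. P = vec_scale c ?A" ..
qed

section \<open>Problem (B): existence and uniqueness\<close>

lemma vec_B_solution:
  assumes "sum m {1..q} = sum n {1..p} + 1"
  shows "vec_B p q r a b \<kappa> n m \<in> solutions_B p q r a b \<kappa> n m"
proof -
  have "poly node_poly (node v) = 0" if "v \<in> nodes" for v
    unfolding poly_node_poly using that finite_nodes by (intro prod_zero) auto
  then show ?thesis
    unfolding solutions_B_node_iff
    using coeff_vec_B_eq_0 sum_vec_B[OF assms regular_point_node']
    by (intro conjI ballI allI impI) (simp_all, simp add: vec_B_def)
qed

text \<open>Over \<open>denom\<close> the combination has a numerator of degree below
  \<open>|m| = |n| + 1\<close>. It vanishes at the \<open>|n|\<close> nodes and at \<open>x\<close>,
  so it is 0, and the numerators are independent.\<close>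

lemma combination_eq_0:
  assumes "sum m {1..q} = sum n {1..p} + 1"
    and "\<And>v. v \<in> nodes \<Longrightarrow> (\<Sum>j\<in>{1..q}. \<Sum>k<m j. c j k * ratfun j k (node v)) = 0"
    and "regular_point x" "x \<notin> node ` nodes" "(\<Sum>j\<in>{1..q}. \<Sum>k<m j. c j k * ratfun j k x) = 0"
    and "j \<in> {1..q}" "k < m j"
  shows "c j k = 0"
proof -
  define f where "f = (\<Sum>j\<in>{1..q}. \<Sum>k<m j. smult (c j k) (numer j k))"
  have f: "poly f y = (\<Sum>j\<in>{1..q}. \<Sum>k<m j. c j k * poly (numer j k) y)" for y
    by (simp add: f_def poly_sum)
  have f_ratfun: "poly f y = poly denom y * (\<Sum>j\<in>{1..q}. \<Sum>k<m j. c j k * ratfun j k y)" if "regular_point y" for y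
    unfolding f sum_distrib_left
    by (intro sum.cong refl) (simp add: poly_numer regular_point_denom[OF that])
  have "f = 0"
  proof (rule poly_eqI_degree)
    have "degree f < sum m {1..q}"
      unfolding f_def using assms(1) degree_numer
      by (intro degree_sum_less) (auto intro: le_less_trans[OF degree_smult_le])
    moreover have "card (insert x (node ` nodes)) = sum m {1..q}"
      using assms(1,4) finite_nodes inj_on_nodes by (simp add: card_image card_nodes)
    ultimately show "degree f < card (insert x (node ` nodes))" "degree 0 < card (insert x (node ` nodes))"
      by auto
    fix y assume "y \<in> insert x (node ` nodes)"
    then show "poly f y = poly 0 y"
      using assms(2,3,5) f_ratfun regular_point_node' by auto
  qed
  then have "(\<Sum>j\<in>{1..q}. \<Sum>k<m j. c j k * poly (numer j k) y) = 0" for y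
    using f by (metis poly_0)
  then show ?thesis
    using assms(6,7) by (rule numer_independent)
qed

lemma solutions_B_main:
  assumes M: "sum m {1..q} = sum n {1..p} + 1"
  shows "vec_B p q r a b \<kappa> n m \<noteq> 0"
    and "Q \<in> solutions_B p q r a b \<kappa> n m \<Longrightarrow> \<exists>c. Q = vec_scale c (vec_B p q r a b \<kappa> n m)"
proof -
  let ?B = "vec_B p q r a b \<kappa> n m"
  let ?S = "\<lambda>Q x. \<Sum>j\<in>{1..q}. \<Sum>k<m j. coeff (Q j) k * ratfun j k x"
  \<comment> \<open>The first lattice point after the nodes of index 1: \<open>node_poly\<close> is
    nonzero there, and it is regular like every \<open>\<kappa> i + k\<close>.\<close>
  define x where "x = \<kappa> 1 + of_nat (n 1)"
  have x: "regular_point x"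
    unfolding x_def using p_pos by (intro regular_point_node) auto
  \<comment> \<open>Injectivity of \<open>node\<close> on the enlarged index set shows that
    \<open>x\<close> coincides with no node.\<close>
  have "(1, n 1) \<in> Sigma {1..p} (\<lambda>i. {..n i})" "nodes \<subseteq> Sigma {1..p} (\<lambda>i. {..n i})" "(1, n 1) \<notin> nodes"
    using p_pos by (auto simp: nodes_def)
  then have x': "x \<notin> node ` nodes"
    using inj_on_image_mem_iff[OF inj_on_node] unfolding x_def node_def by (metis case_prod_conv)
  have "poly node_poly x \<noteq> 0"
    unfolding poly_node_poly using x' finite_nodes by (auto simp del: split_paired_All)
  then have nz: "?S ?B x \<noteq> 0"
    unfolding sum_vec_B[OF M x] using regular_point_denom[OF x] by simp
  then show "?B \<noteq> 0" by (auto simp del: split_paired_All)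
  assume Q: "Q \<in> solutions_B p q r a b \<kappa> n m"
  \<comment> \<open>With this \<open>c\<close> the difference \<open>Q'\<close> gives a combination
    that vanishes at \<open>x\<close> as well as at the nodes.\<close>
  define c where "c = ?S Q x / ?S ?B x"
  define Q' where "Q' = (\<lambda>j. Q j - vec_scale c ?B j)"
  have S: "?S Q' y = ?S Q y - c * ?S ?B y" for y
    by (simp add: Q'_def vec_scale_def left_diff_distrib sum_subtractf sum_distrib_left mult.assoc)
  note B = vec_B_solution[OF M]
  have "Q j = vec_scale c ?B j" for j
  proof (cases "j \<in> {1..q}")
    case j: True
    show ?thesis
    proof (rule poly_eqI)
      fix k
      show "coeff (Q j) k = coeff (vec_scale c ?B j) k"
      proof (cases "k < m j")
        case True
        have "coeff (Q' j) k = 0"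
        proof (rule combination_eq_0[OF M _ x x' _ j True])
          show "?S Q' (node v) = 0" if "v \<in> nodes" for v
            unfolding S using Q B that by (simp add: solutions_B_node_iff del: split_paired_All)
          show "?S Q' x = 0" unfolding S c_def using nz by simp
        qed
        then show ?thesis by (simp add: Q'_def)
      next
        case False
        then show ?thesis using Q B j by (simp add: solutions_B_node_iff vec_scale_def)
      qed
    qed
  next
    case False
    then show ?thesis using Q B by (simp add: solutions_B_node_iff vec_scale_def)
  qed
  then show "\<exists>c. Q = vec_scale c ?B" by blast
qed

end

theorem proposition4p5:
  fixes p q r :: nat
    and a b \<kappa> :: "nat \<Rightarrow> complex"
    and n m :: "nat \<Rightarrow> nat"
  assumes "1 \<le> p" and "1 \<le> q" and "r < q"
    and "regular p q b \<kappa>"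
    and "near_diagonal q m"
    and "admissible p q r a b \<kappa> m"
  shows "((\<Sum>i\<in>{1..p}. n i) = (\<Sum>j\<in>{1..q}. m j) + 1 \<longrightarrow>
           one_dimensional (solutions_A p q r a b \<kappa> n m) \<and>
           vec_A p q r a b \<kappa> n m \<in> solutions_A p q r a b \<kappa> n m \<and>
           vec_A p q r a b \<kappa> n m \<noteq> 0 \<and>
           (\<forall>P\<in>solutions_A p q r a b \<kappa> n m. \<exists>c. P = vec_scale c (vec_A p q r a b \<kappa> n m))) \<and>
         ((\<Sum>j\<in>{1..q}. m j) = (\<Sum>i\<in>{1..p}. n i) + 1 \<longrightarrow>
           one_dimensional (solutions_B p q r a b \<kappa> n m) \<and>
           vec_B p q r a b \<kappa> n m \<in> solutions_B p q r a b \<kappa> n m \<and>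
           vec_B p q r a b \<kappa> n m \<noteq> 0 \<and>
           (\<forall>Q\<in>solutions_B p q r a b \<kappa> n m. \<exists>c. Q = vec_scale c (vec_B p q r a b \<kappa> n m)))"
proof -
  interpret hypergeometric_system p q r a b \<kappa> n m
  proof
    show "m j \<le> m h + 1" if "j \<in> {1..q}" "h \<in> {1..q}" for j h
      using assms(5) that unfolding near_diagonal_def by fastforce
  qed (use assms in \<open>auto simp: regular_def admissible_def\<close>)
  show ?thesis
  proof (rule conjI; rule impI)
    assume N: "sum n {1..p} = sum m {1..q} + 1"
    show "one_dimensional (solutions_A p q r a b \<kappa> n m) \<and>
        vec_A p q r a b \<kappa> n m \<in> solutions_A p q r a b \<kappa> n m \<and>
        vec_A p q r a b \<kappa> n m \<noteq> 0 \<and>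
        (\<forall>P\<in>solutions_A p q r a b \<kappa> n m. \<exists>c. P = vec_scale c (vec_A p q r a b \<kappa> n m))"
      by (intro conjI ballI one_dimensionalI[of "vec_A p q r a b \<kappa> n m"] vec_scale_in_solutions_A vec_A_solution[OF N] solutions_A_main[OF N])
  next
    assume M: "sum m {1..q} = sum n {1..p} + 1"
    show "one_dimensional (solutions_B p q r a b \<kappa> n m) \<and>
        vec_B p q r a b \<kappa> n m \<in> solutions_B p q r a b \<kappa> n m \<and>
        vec_B p q r a b \<kappa> n m \<noteq> 0 \<and>
        (\<forall>Q\<in>solutions_B p q r a b \<kappa> n m. \<exists>c. Q = vec_scale c (vec_B p q r a b \<kappa> n m))"
      by (intro conjI ballI one_dimensionalI[of "vec_B p q r a b \<kappa> n m"] vec_scale_in_solutions_B vec_B_solution[OF M] solutions_B_main[OF M])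
  qed
qed

end
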